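(* In the setting described in the context, consider the smoothed equation $$\dot x(t)=-\mu x(t)+\tilde a(t)\tilde f(x(t-1)).\qquad(\tilde a,\tilde f)$$ For $\delta>0$ (and $\rho>0$) small enough, the map $\tilde F$ has a unique fixed point $\tilde h$ close to $h_*$ (that is, there is a neighborhood of $h_*$, independent of small $\delta$ and $\rho$, in which $\tilde F$ has exactly one fixed point), with $$\tilde h\to h_*\quad\text{and}\quad\tilde F'(\tilde h)\to F'(h_* )=m\quad\text{as }\delta\to0.$$ To this fixed point corresponds a periodic solution $\tilde p:\mathbb R\to\mathbb R$ of equation $(\tilde a,\tilde f)$ with (minimal) period $p_1+p_2$.
   Context: Setting. $\mu,a_1,a_2,p_1,p_2>0$, $T=p_1+p_2$. For $h>0$ put $t_1(h)=\frac1\mu\ln\frac{\mu h+a_1}{a_1}$ and $t_2(h)=t_1(h)+1+\frac1\mu\ln(2-e^{-\mu})$. Let $$m=\Big[2\tfrac{a_2}{a_1}-e^{-\mu}\Big](2-e^{-\mu})e^{-\mu(T-2)},\quad b=\tfrac{2a_2-a_1e^{-\mu}}{\mu}(2-e^{-\mu})e^{-\mu(T-2)}+\tfrac{a_1-a_2}{\mu}e^{-\mu p_2}-\tfrac{a_2}{\mu},$$ and $F(h)=mh+b$. Standing assumption: $m\ne1$, $h_*>0$ is the fixed point of $F$, and at $h=h_*$ one has $0<t_1<t_1+1<t_2<p_1<t_2+1<T$. ($F$ is the map $h=x(0)\mapsto x(T)$ for the discontinuous equation $\dot x(t)=-\mu x(t)-a(t)\operatorname{sign}(x(t-1))$, $a$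 being $T$-periodic with $a=a_1$ on $[0,p_1)$, $a=a_2$ on $[p_1,T)$, for positive initial functions and $h$ near $h_*$.) Smoothed data (for $\delta,\rho>0$). $\tilde f:\mathbb R\to\mathbb R$ is $C^\infty$, $\tilde f(x)=-\operatorname{sign}(x)$ for $|x|\ge\delta$, $-1\le\tilde f(x)\le1$ for $|x|\le\delta$, and, with $\alpha=-a_1/\mu$, $\int_{-\delta}^{\delta}\frac{\tilde f(u)}{(\alpha-u)^2}du=\int_{-\delta}^{\delta}\frac{-\operatorname{sign}(u)}{(\alpha-u)^2}du$. The function $\tilde a:\mathbb R\to\mathbb R$ is $C^\infty$, $T$-periodic, $\tilde a=a_1$ on $[\rho,p_1]$, $\tilde a=a_2$ on $[p_1+\rho,T]$, $0<\tilde a\le2\max\{a_1,a_2\}$ on $[0,\rho]\cup[p_1,p_1+\rho]$, and $\int_0^\rho\tilde a(s)e^{\mu s}ds=a_1\int_0^\rho e^{\mu s}ds$, $\int_{p_1}^{p_1+\rho}\tilde a(s)e^{\mu s}ds=a_2\int_{p_1}^{p_1+\rho}e^{\mu s}ds$. The map $\tilde F$ (for $h$ near $h_*$): $\tilde F(h)=x(T)$, where $x$ is the solution of $(\tilde a,\tilde f)$ for $t\ge0$ with any initial function $\varphi\in C^0([-1,0],\mathbb R)$ satisfying $\varphi\ge\delta$ on $[-1,0]$ and $\varphi(0)=h$ (the solution on $[0,\infty)$ depends only on $h$). "Corresponds" means: $\tilde p(0)=\tilde h$ and $\tilde p|_{[-1,0]}=x(T+\cdot)|_{[-1,0]}$,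 where $x$ is the solution of $(\tilde a,\tilde f)$ with constant initial function $\tilde h$. *)

theory Defs
  imports "HOL-Analysis.Analysis"
begin

subsection \<open>The discontinuous equation: switching times and return map\<close>

definition switch1 :: "real \<Rightarrow> real \<Rightarrow> real \<Rightarrow> real" where
  "switch1 \<mu> a1 h = (1 / \<mu>) * ln ((\<mu> * h + a1) / a1)"

definition switch2 :: "real \<Rightarrow> real \<Rightarrow> real \<Rightarrow> real" where
  "switch2 \<mu> a1 h = switch1 \<mu> a1 h + 1 + (1 / \<mu>) * ln (2 - exp (- \<mu>))"

definition slope :: "real \<Rightarrow> real \<Rightarrow> real \<Rightarrow> real \<Rightarrow> real \<Rightarrow> real" where
  "slope \<mu> a1 a2 p1 p2 =
     (2 * (a2 / a1) - exp (- \<mu>)) * (2 - exp (- \<mu>)) * exp (- \<mu> * (p1 + p2 - 2))"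

definition offset :: "real \<Rightarrow> real \<Rightarrow> real \<Rightarrow> real \<Rightarrow> real \<Rightarrow> real" where
  "offset \<mu> a1 a2 p1 p2 =
     (2 * a2 - a1 * exp (- \<mu>)) / \<mu> * (2 - exp (- \<mu>)) * exp (- \<mu> * (p1 + p2 - 2))
     + (a1 - a2) / \<mu> * exp (- \<mu> * p2) - a2 / \<mu>"

definition return_map :: "real \<Rightarrow> real \<Rightarrow> real \<Rightarrow> real \<Rightarrow> real \<Rightarrow> real \<Rightarrow> real" where
  "return_map \<mu> a1 a2 p1 p2 h = slope \<mu> a1 a2 p1 p2 * h + offset \<mu> a1 a2 p1 p2"

subsection \<open>Smoothed data\<close>

definition C_infinity :: "(real \<Rightarrow> real) \<Rightarrow> bool" where
  "C_infinity g \<longleftrightarrow> (\<forall>n x. (deriv ^^ n) g differentiable (at x))"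

definition smoothed_feedback :: "real \<Rightarrow> real \<Rightarrow> real \<Rightarrow> (real \<Rightarrow> real) \<Rightarrow> bool" where
  "smoothed_feedback \<mu> a1 \<delta> f \<longleftrightarrow>
     C_infinity f \<and>
     (\<forall>x. \<bar>x\<bar> \<ge> \<delta> \<longrightarrow> f x = - sgn x) \<and>
     (\<forall>x. \<bar>x\<bar> \<le> \<delta> \<longrightarrow> - 1 \<le> f x \<and> f x \<le> 1) \<and>
     (let \<alpha> = - a1 / \<mu> in
        integral {-\<delta>..\<delta>} (\<lambda>u. f u / (\<alpha> - u)\<^sup>2) =
        integral {-\<delta>..\<delta>} (\<lambda>u. - sgn u / (\<alpha> - u)\<^sup>2))"

definition smoothed_coefficient ::
  "real \<Rightarrow> real \<Rightarrow> real \<Rightarrow> real \<Rightarrow> real \<Rightarrow> real \<Rightarrow> (real \<Rightarrow> real) \<Rightarrow> bool" where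
  "smoothed_coefficient \<mu> a1 a2 p1 p2 \<rho> a \<longleftrightarrow>
     C_infinity a \<and>
     (\<forall>t. a (t + (p1 + p2)) = a t) \<and>
     (\<forall>t\<in>{\<rho>..p1}. a t = a1) \<and>
     (\<forall>t\<in>{p1 + \<rho>..p1 + p2}. a t = a2) \<and>
     (\<forall>t\<in>{0..\<rho>} \<union> {p1..p1 + \<rho>}. 0 < a t \<and> a t \<le> 2 * max a1 a2) \<and>
     integral {0..\<rho>} (\<lambda>s. a s * exp (\<mu> * s)) =
       a1 * integral {0..\<rho>} (\<lambda>s. exp (\<mu> * s)) \<and>
     integral {p1..p1 + \<rho>} (\<lambda>s. a s * exp (\<mu> * s)) =
       a2 * integral {p1..p1 + \<rho>} (\<lambda>s. exp (\<mu> * s))"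

subsection \<open>Solutions of the smoothed equation and its return map\<close>

text \<open>
  A solution of the initial value problem is a function on \<open>[-1, \<infinity>)\<close>; values to the
  left of \<open>-1\<close> are irrelevant. At \<open>t = 0\<close> the derivative is the right-hand one.
\<close>

definition solves_ivp ::
  "real \<Rightarrow> (real \<Rightarrow> real) \<Rightarrow> (real \<Rightarrow> real) \<Rightarrow> (real \<Rightarrow> real) \<Rightarrow> (real \<Rightarrow> real) \<Rightarrow> bool" where
  "solves_ivp \<mu> a f \<phi> x \<longleftrightarrow>
     continuous_on {-1..} x \<and>
     (\<forall>t\<in>{-1..0}. x t = \<phi> t) \<and>
     (\<forall>t\<ge>0. (x has_real_derivative (- \<mu> * x t + a t * f (x (t - 1)))) (at t within {0..}))"

definition solves_on_line ::
  "real \<Rightarrow> (real \<Rightarrow> real) \<Rightarrow> (real \<Rightarrow> real) \<Rightarrow> (real \<Rightarrow> real) \<Rightarrow> bool" where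
  "solves_on_line \<mu> a f p \<longleftrightarrow>
     (\<forall>t. (p has_real_derivative (- \<mu> * p t + a t * f (p (t - 1)))) (at t))"

definition minimal_period :: "real \<Rightarrow> (real \<Rightarrow> real) \<Rightarrow> bool" where
  "minimal_period T p \<longleftrightarrow>
     0 < T \<and> (\<forall>t. p (t + T) = p t) \<and>
     (\<forall>\<tau>. 0 < \<tau> \<and> \<tau> < T \<longrightarrow> \<not> (\<forall>t. p (t + \<tau>) = p t))"

definition admissible_initial :: "real \<Rightarrow> real \<Rightarrow> (real \<Rightarrow> real) \<Rightarrow> bool" where
  "admissible_initial \<delta> h \<phi> \<longleftrightarrow>
     continuous_on {-1..0} \<phi> \<and> (\<forall>s\<in>{-1..0}. \<delta> \<le> \<phi> s) \<and> \<phi> 0 = h"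

text \<open>
  The common value at time \<open>T\<close> of all solutions with admissible initial function. It is
  meaningful for \<open>h \<ge> \<delta>\<close>, see \<open>smoothed_return_map_eq\<close> and \<open>solves_ivp_exists\<close> below; for
  \<open>h < \<delta>\<close> there is no admissible initial function and the value is unspecified.
\<close>

definition smoothed_return_map ::
  "real \<Rightarrow> (real \<Rightarrow> real) \<Rightarrow> (real \<Rightarrow> real) \<Rightarrow> real \<Rightarrow> real \<Rightarrow> real \<Rightarrow> real" where
  "smoothed_return_map \<mu> a f \<delta> T h =
     (THE y. \<exists>\<phi> x. admissible_initial \<delta> h \<phi> \<and> solves_ivp \<mu> a f \<phi> x \<and> y = x T)"

definition corresponding_solution ::
  "real \<Rightarrow> (real \<Rightarrow> real) \<Rightarrow> (real \<Rightarrow> real) \<Rightarrow> real \<Rightarrow> real \<Rightarrow> (real \<Rightarrow> real) \<Rightarrow> bool" where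
  "corresponding_solution \<mu> a f T h p \<longleftrightarrow>
     solves_on_line \<mu> a f p \<and> p 0 = h \<and>
     (\<exists>x. solves_ivp \<mu> a f (\<lambda>_. h) x \<and> (\<forall>s\<in>{-1..0}. p s = x (T + s)))"

subsection \<open>Well-definedness of the smoothed return map\<close>

lemma C_infinity_continuous_on: "C_infinity g \<Longrightarrow> continuous_on A g"
  unfolding C_infinity_def
  by (metis continuous_at_imp_continuous_on differentiable_imp_continuous_within funpow_0)

lemma solves_ivp_unique:
  assumes x: "solves_ivp \<mu> a f \<phi> x" and y: "solves_ivp \<mu> a f \<psi> y"
    and f: "\<And>u. u \<ge> \<delta> \<Longrightarrow> f u = -1"
    and \<phi>: "admissible_initial \<delta> h \<phi>" and \<psi>: "admissible_initial \<delta> h \<psi>"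
    and "t \<ge> 0"
  shows "x t = y t"
proof -
  have "\<forall>t\<in>{0..real n}. x t = y t" for n
  proof (induction n)
    case 0
    then show ?case
      using x y \<phi> \<psi> by (auto simp: solves_ivp_def admissible_initial_def)
  next
    case (Suc n)
    show ?case
    proof
      fix t assume t: "t \<in> {0..real (Suc n)}"
      define d where "d s = exp (\<mu> * s) * (x s - y s)" for s
      have "(d has_real_derivative 0) (at s within {0..t})" if s: "s \<in> {0..t}" for s
      proof -
        have eq: "f (x (s - 1)) = f (y (s - 1))"
        proof (cases "s \<ge> 1")
          case True
          then have "s - 1 \<in> {0..real n}" using s t by auto
          then show ?thesis using Suc by auto
        next
          case False
          then have "s - 1 \<in> {-1..0}" using s by auto
          then show ?thesis
            using x y \<phi> \<psi> f by (auto simp: solves_ivp_def admissible_initial_def)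
        qed
        have "(x has_real_derivative (- \<mu> * x s + a s * f (x (s - 1)))) (at s within {0..t})"
          and "(y has_real_derivative (- \<mu> * y s + a s * f (y (s - 1)))) (at s within {0..t})"
          using x y s by (auto simp: solves_ivp_def intro: DERIV_subset)
        then show ?thesis
          unfolding d_def by (auto intro!: derivative_eq_intros simp: eq algebra_simps)
      qed
      then obtain c where "\<forall>s\<in>{0..t}. d s = c"
        using has_field_derivative_zero_constant[of "{0..t}" d] by auto
      then have "d t = d 0" using t by auto
      also have "\<dots> = 0"
        using x y \<phi> \<psi> by (auto simp: d_def solves_ivp_def admissible_initial_def)
      finally show "x t = y t" by (simp add: d_def)
    qed
  qed
  moreover obtain n where "t \<le> real n" using real_arch_simple by blast
  ultimately show ?thesis using \<open>t \<ge> 0\<close> by auto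
qed

lemma solves_ivp_exists:
  assumes a: "continuous_on UNIV a" and f: "continuous_on UNIV f"
    and \<phi>: "continuous_on {-1..0} \<phi>"
  shows "\<exists>x. solves_ivp \<mu> a f \<phi> x"
proof -
  define I where "I x s = exp (\<mu> * s) * (a s * f (x (s - 1)))" for x :: "real \<Rightarrow> real" and s
  define G where "G x t = (if t \<le> 0 then \<phi> t
      else exp (- \<mu> * t) * (\<phi> 0 + integral {0..t} (I x)))" for x t
  define X where "X n = (G ^^ n) (\<lambda>t. \<phi> (min t 0))" for n
  have X0: "X 0 = (\<lambda>t. \<phi> (min t 0))" and XS: "X (Suc n) = G (X n)" for n
    by (auto simp: X_def)
  have I: "continuous_on {0..T} (I x)" if "continuous_on {-1..} x" for x T
  proof -
    have "continuous_on {0..T} (\<lambda>s. x (s - 1))"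
      by (rule continuous_on_compose2[OF that]) (auto intro!: continuous_intros)
    then have "continuous_on {0..T} (\<lambda>s. f (x (s - 1)))"
      by (rule continuous_on_compose2[OF f]) auto
    then show ?thesis
      unfolding I_def by (intro continuous_intros continuous_on_subset[OF a]) auto
  qed
  have G0: "G x t = exp (- \<mu> * t) * (\<phi> 0 + integral {0..t} (I x))" if "t \<ge> 0" for x t
    using that by (cases "t = 0") (auto simp: G_def)
  have dG: "(G x has_real_derivative (- \<mu> * G x t + a t * f (x (t - 1)))) (at t within {0..})"
    if x: "continuous_on {-1..} x" and t: "t \<ge> 0" for x t
  proof -
    have "((\<lambda>t. integral {0..t} (I x)) has_real_derivative I x t) (at t within {0..t + 1})"
      using integral_has_real_derivative[OF I[OF x], of t "t + 1"] t by auto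
    then have "((\<lambda>t. exp (- \<mu> * t) * (\<phi> 0 + integral {0..t} (I x)))
        has_real_derivative (- \<mu> * G x t + a t * f (x (t - 1)))) (at t within {0..t + 1})"
      using t by (auto intro!: derivative_eq_intros
          simp: G0 I_def algebra_simps exp_minus)
    then have "(G x has_real_derivative (- \<mu> * G x t + a t * f (x (t - 1))))
        (at t within {0..t + 1})"
      using t by (rule_tac has_field_derivative_transform_within[where d = 1]) (auto simp: G0)
    moreover have "at t within {0..t + 1} = at t within {0..}"
      by (rule at_within_nhd[where S = "{..<t + 1}"]) auto
    ultimately show ?thesis by simp
  qed
  have glue: "continuous_on {-1..} z"
    if "\<And>t. t \<in> {-1..0} \<Longrightarrow> z t = \<phi> t" "continuous_on {0..} z" for z
  proof -
    have "continuous_on {-1..0} z"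
      using \<phi> by (rule continuous_on_eq) (simp add: that)
    then have "continuous_on ({-1..0} \<union> {0..}) z"
      using that by (intro continuous_on_closed_Un) auto
    moreover have "{-1..0} \<union> {0::real..} = {-1..}" by auto
    ultimately show ?thesis by simp
  qed
  have X\<phi>: "X n t = \<phi> t" if "t \<in> {-1..0}" for n t
    using that by (cases n) (auto simp: X0 XS G_def)
  have Xc: "continuous_on {-1..} (X n)" for n
  proof (induction n)
    case 0
    show ?case
      by (rule glue[OF X\<phi>]) (auto simp: X0 min_def intro: continuous_on_eq[OF continuous_on_const[of _ "\<phi> 0"]])
  next
    case (Suc n)
    have "continuous_on {0..} (G (X n))"
      by (rule DERIV_continuous_on) (rule dG[OF Suc], simp)
    then show ?case using X\<phi>[of _ "Suc n"] by (intro glue) (auto simp: XS)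
  qed
  have step: "\<forall>t\<in>{-1..real n}. X (Suc n) t = X n t" for n
  proof (induction n)
    case 0
    then show ?case using X\<phi> by auto
  next
    case (Suc n)
    have "integral {0..t} (I (X (Suc n))) = integral {0..t} (I (X n))" if "t \<le> real (Suc n)" for t
      using that Suc by (intro integral_cong) (auto simp: I_def)
    then show ?case by (auto simp: XS[of "Suc n"] XS[of n] G_def simp flip: of_nat_Suc)
  qed
  have le: "X m t = X n t" if "n \<le> m" "t \<in> {-1..real n}" for m n t
    using that(1)
  proof (induction m rule: dec_induct)
    case (step m)
    then show ?case using that(2) \<open>\<And>n. \<forall>t\<in>{-1..real n}. X (Suc n) t = X n t\<close>[of m] by auto
  qed simp
  define x where "x t = X (nat \<lceil>t\<rceil>) t" for t
  have x: "x t = X n t" if "t \<in> {-1..real n}" for t n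
    unfolding x_def using that le[of "nat \<lceil>t\<rceil>" n t] by (auto simp: nat_le_iff ceiling_le_iff) linarith
  have dx: "(x has_real_derivative (- \<mu> * x t + a t * f (x (t - 1)))) (at t within {0..})"
    if t: "t \<ge> 0" for t
  proof -
    obtain n where n: "t + 1 \<le> real n" using real_arch_simple by blast
    have "(X (Suc n) has_real_derivative (- \<mu> * x t + a t * f (x (t - 1)))) (at t within {0..})"
      using dG[OF Xc t, of n] n t x[of t "Suc n"] x[of "t - 1" n] by (simp add: XS)
    then show ?thesis
    proof (rule has_field_derivative_transform_within[where d = 1])
      show "X (Suc n) s = x s" if "s \<in> {0..}" "dist s t < 1" for s
        using that n t by (subst x[of s "Suc n"]) (auto simp: dist_real_def)
    qed (use t in simp_all)
  qed
  have x\<phi>: "x t = \<phi> t" if "t \<in> {-1..0}" for t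
    using that x[of t 0] X\<phi>[of t 0] by auto
  have "continuous_on {0..} x"
    by (rule DERIV_continuous_on) (rule dx, simp)
  then have "solves_ivp \<mu> a f \<phi> x"
    unfolding solves_ivp_def using dx x\<phi> glue[of x] by simp
  then show ?thesis by blast
qed

lemma smoothed_return_map_eq:
  assumes "smoothed_feedback \<mu> a1 \<delta> f" "\<delta> > 0" "T \<ge> 0"
    and "admissible_initial \<delta> h \<phi>" "solves_ivp \<mu> a f \<phi> x"
  shows "smoothed_return_map \<mu> a f \<delta> T h = x T"
proof -
  have f: "f u = -1" if "u \<ge> \<delta>" for u
    using assms(1,2) that by (auto simp: smoothed_feedback_def)
  show ?thesis
    unfolding smoothed_return_map_def
  proof (rule the_equality)
    show "\<exists>\<phi> y. admissible_initial \<delta> h \<phi> \<and> solves_ivp \<mu> a f \<phi> y \<and> x T = y T"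
      using assms(4,5) by blast
  next
    fix z
    assume "\<exists>\<psi> y. admissible_initial \<delta> h \<psi> \<and> solves_ivp \<mu> a f \<psi> y \<and> z = y T"
    then obtain \<psi> y where y: "admissible_initial \<delta> h \<psi>" "solves_ivp \<mu> a f \<psi> y" "z = y T"
      by blast
    show "z = x T"
      using solves_ivp_unique[OF y(2) assms(5) f y(1) assms(4,3)] y(3) by simp
  qed
qed

end

theory Submission
  imports Defs
begin

text \<open>
  Multiplying the equation by \<open>exp (\<mu> * t)\<close> turns every stretch on which the delayed feedback is
  constant into an integral of the coefficient; the integral conditions on the smoothed
  coefficient make these integrals independent of \<open>\<rho>\<close> outside the short smoothing intervals. When the
  delayed argument crosses \<open>[-\<delta>, \<delta>]\<close>, it runs along an explicit exponential, so substituting the state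
  for the time gives an integral of \<open>f u / (w - u)\<^sup>2\<close>. At the first crossing this integral is the
  one prescribed for \<open>f\<close>, and the smoothed orbit rejoins the discontinuous one exactly; at the
  second one it is only \<open>O(\<delta>)\<close> but enters multiplied by an affine function of \<open>h\<close>. Hence the
  smoothed return map is affine near \<open>hs\<close>, with a slope within \<open>O(\<delta>)\<close> of that of the
  discontinuous one. Minimality of the period holds because the periodic solution is
  negative on a single interval per period.
\<close>

subsection \<open>Crossing times and elementary integrals\<close>

text \<open>The time at which \<open>K * exp (- \<mu> * t)\<close> has decayed to \<open>w\<close>.
  The falling orbit \<open>K * exp (- \<mu> * t) - A\<close> meets the level \<open>v\<close> for
  \<open>w = A + v\<close>; the rising orbit \<open>A - C * exp (- \<mu> * t)\<close> meets it for
  \<open>w = A - v\<close>, with \<open>C\<close> in place of \<open>K\<close>.\<close>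

definition crossing :: "real \<Rightarrow> real \<Rightarrow> real \<Rightarrow> real" where
  "crossing \<mu> K w = ln (K / w) / \<mu>"

text \<open>Comparing a time with a crossing becomes an inequality linear in
  \<open>exp (\<mu> * t)\<close>, so later comparisons avoid logarithms.\<close>

lemma
  assumes "\<mu> > 0" "K > 0" "w > 0"
  shows exp_crossing: "exp (\<mu> * crossing \<mu> K w) = K / w"
    and le_crossing_iff: "t \<le> crossing \<mu> K w \<longleftrightarrow> w * exp (\<mu> * t) \<le> K"
    and crossing_le_iff: "crossing \<mu> K w \<le> t \<longleftrightarrow> K \<le> w * exp (\<mu> * t)"
proof -
  show e: "exp (\<mu> * crossing \<mu> K w) = K / w"
    using assms by (simp add: crossing_def)
  have "t \<le> crossing \<mu> K w \<longleftrightarrow> exp (\<mu> * t) \<le> K / w"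
    using assms(1) by (simp flip: e)
  then show "t \<le> crossing \<mu> K w \<longleftrightarrow> w * exp (\<mu> * t) \<le> K"
    using assms by (simp add: field_simps)
  have "crossing \<mu> K w \<le> t \<longleftrightarrow> K / w \<le> exp (\<mu> * t)"
    using assms(1) by (simp flip: e)
  then show "crossing \<mu> K w \<le> t \<longleftrightarrow> K \<le> w * exp (\<mu> * t)"
    using assms by (simp add: field_simps)
qed

lemma integral_exp_linear:
  fixes \<mu> u v :: real
  assumes "\<mu> \<noteq> 0" "u \<le> v"
  shows "integral {u..v} (\<lambda>s. exp (\<mu> * s)) = (exp (\<mu> * v) - exp (\<mu> * u)) / \<mu>"
proof -
  have "((\<lambda>s. exp (\<mu> * s)) has_integral exp (\<mu> * v) / \<mu> - exp (\<mu> * u) / \<mu>) {u..v}"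
    using assms
    by (intro fundamental_theorem_of_calculus)
      (auto intro!: derivative_eq_intros simp flip: has_real_derivative_iff_has_vector_derivative)
  then show ?thesis by (simp add: integral_unique diff_divide_distrib)
qed

text \<open>Antiderivatives \<open>c / (- A - u)\<close> on the two sides of 0 are glued there. The
  fundamental theorem is applied in its interior form because the integrand jumps at 0.\<close>

lemma integral_neg_sgn_over_square:
  fixes A \<delta> :: real
  assumes "0 < \<delta>" "\<delta> < A"
  shows "integral {-\<delta>..\<delta>} (\<lambda>u. - sgn u / (- A - u)\<^sup>2) = 1 / (A - \<delta>) + 1 / (A + \<delta>) - 2 / A"
proof -
  have D: "((\<lambda>u. c / (- A - u)) has_vector_derivative c / (- A - u)\<^sup>2) (at u)"
    if "-\<delta> < u" "u < \<delta>" for c u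
    unfolding has_real_derivative_iff_has_vector_derivative[symmetric] using that assms
    by (auto intro!: derivative_eq_intros simp: power2_eq_square)
  have "((\<lambda>u. - sgn u / (- A - u)\<^sup>2) has_integral 1 / (- A - 0) - 1 / (- A - (-\<delta>))) {-\<delta>..0}"
    using assms
    by (intro fundamental_theorem_of_calculus_interior continuous_intros)
      (auto intro!: has_vector_derivative_eq_rhs[OF D])
  moreover
  have "((\<lambda>u. - sgn u / (- A - u)\<^sup>2) has_integral (- 1) / (- A - \<delta>) - (- 1) / (- A - 0)) {0..\<delta>}"
    using assms
    by (intro fundamental_theorem_of_calculus_interior continuous_intros)
      (auto intro!: has_vector_derivative_eq_rhs[OF D[of _ "-1", simplified]])
  ultimately have "((\<lambda>u. - sgn u / (- A - u)\<^sup>2) has_integral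
      (1 / (- A - 0) - 1 / (- A - (-\<delta>))) + ((- 1) / (- A - \<delta>) - (- 1) / (- A - 0))) {-\<delta>..\<delta>}"
    using assms by (intro has_integral_combine) auto
  also have "(1 / (- A - 0) - 1 / (- A - (-\<delta>))) + ((- 1) / (- A - \<delta>) - (- 1) / (- A - 0)) =
      1 / (A - \<delta>) + 1 / (A + \<delta>) - 2 / A"
  proof -
    have "- A - \<delta> = - (A + \<delta>)" "- A - (-\<delta>) = - (A - \<delta>)" by simp_all
    then show ?thesis by (simp only: minus_divide_right[symmetric] minus_divide_left[symmetric]) simp
  qed
  finally show ?thesis by (rule integral_unique)
qed

text \<open>
  After the first crossing the orbit is \<open>a1 / \<mu> - rise_amplitude \<mu> a1 h * exp (- \<mu> * t)\<close>.
\<close>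

definition rise_amplitude :: "real \<Rightarrow> real \<Rightarrow> real \<Rightarrow> real" where
  "rise_amplitude \<mu> a1 h = (h + a1 / \<mu>) * exp \<mu> * (2 - exp (- \<mu>))"

text \<open>
  The orbit passes \<open>\<delta>\<close> and \<open>-\<delta>\<close> downwards at \<open>\<tau>\<close> and \<open>\<tau>'\<close>, and \<open>-\<delta>\<close> and \<open>\<delta>\<close> upwards at \<open>\<sigma>\<close> and \<open>\<sigma>'\<close>.
  Besides the order of these times, the three inequalities not about times keep the orbit
  below \<open>-\<delta>\<close> on \<open>[\<tau> + 1, \<tau>' + 1]\<close>, above \<open>\<delta>\<close> on \<open>[p1, \<sigma> + 1]\<close>, and above \<open>\<delta>\<close> on
  \<open>[\<sigma> + 1, p1 + p2]\<close>. At \<open>\<delta> = \<rho> = 0\<close> the last one reads \<open>0 < exp (\<mu> * (p1 + p2)) * return_map h\<close>.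
\<close>

definition nondegenerate ::
  "real \<Rightarrow> real \<Rightarrow> real \<Rightarrow> real \<Rightarrow> real \<Rightarrow> real \<Rightarrow> real \<Rightarrow> real \<Rightarrow> bool" where
  "nondegenerate \<mu> a1 a2 p1 p2 h \<delta> \<rho> \<longleftrightarrow>
     (let A = a1 / \<mu>; B = a2 / \<mu>; K = h + A; C = rise_amplitude \<mu> a1 h;
          \<tau> = crossing \<mu> K (A + \<delta>); \<tau>' = crossing \<mu> K (A - \<delta>);
          \<sigma> = crossing \<mu> C (A + \<delta>); \<sigma>' = crossing \<mu> C (A - \<delta>)
      in 0 < K \<and> \<delta> < A \<and> \<rho> < \<tau> \<and> \<tau>' < \<tau> + 1 \<and>
         A + \<delta> < (A - \<delta>) * (2 * A / (A + \<delta>) - exp (- \<mu>)) \<and>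
         \<tau>' + 1 < \<sigma> \<and> \<sigma>' < p1 \<and> p1 + \<rho> < \<sigma> + 1 \<and> \<sigma>' + 1 < p1 + p2 \<and>
         \<delta> < exp (- \<mu>) * (A - C * exp (- \<mu> * p1)) \<and>
         \<delta> * exp (\<mu> * (p1 + p2)) <
           C * (2 * B * exp \<mu> / (A + \<delta>) - 1) + (A - B) * exp (\<mu> * p1) - B * exp (\<mu> * (p1 + p2)))"

text \<open>The coefficient of \<open>h + a1 / \<mu>\<close> in \<open>x_return\<close>. The
  reciprocals come from the ends of the second transition, the integral from the transition itself.
  Its pole is at \<open>a1 / \<mu>\<close>, whereas the condition on \<open>f\<close> concerns the
  pole \<open>- a1 / \<mu>\<close>.\<close>

definition smoothed_slope ::
  "real \<Rightarrow> real \<Rightarrow> real \<Rightarrow> real \<Rightarrow> real \<Rightarrow> real \<Rightarrow> (real \<Rightarrow> real) \<Rightarrow> real" where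
  "smoothed_slope \<mu> a1 a2 p1 p2 \<delta> f =
     exp (- \<mu> * (p1 + p2)) * exp \<mu> * (2 - exp (- \<mu>)) *
       (a2 / \<mu> * exp \<mu> * (1 / (a1 / \<mu> + \<delta>) + 1 / (a1 / \<mu> - \<delta>)
          + integral {-\<delta>..\<delta>} (\<lambda>u. f u / (a1 / \<mu> - u)\<^sup>2)) - 1)"

text \<open>Independent of \<open>f\<close>, of \<open>a\<close> and of \<open>\<rho>\<close>, which
  makes all later estimates uniform in the smoothed data.\<close>

definition slope_error_bound :: "real \<Rightarrow> real \<Rightarrow> real \<Rightarrow> real \<Rightarrow> real \<Rightarrow> real \<Rightarrow> real" where
  "slope_error_bound \<mu> a1 a2 p1 p2 \<delta> =
     exp (- \<mu> * (p1 + p2)) * exp \<mu> * (2 - exp (- \<mu>)) * (a2 / \<mu>) * exp \<mu> *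
       (\<bar>1 / (a1 / \<mu> + \<delta>) + 1 / (a1 / \<mu> - \<delta>) - 2 / (a1 / \<mu>)\<bar>
          + 2 * \<delta> / (a1 / \<mu> - \<delta>)\<^sup>2)"

text \<open>Brought into the shape of \<open>smoothed_slope\<close>: \<open>2 / (a1 / \<mu>)\<close>
  stands where that has two reciprocals and an integral.\<close>

lemma slope_eq:
  assumes "\<mu> > 0" "a1 > 0"
  shows "slope \<mu> a1 a2 p1 p2 = exp (- \<mu> * (p1 + p2)) * exp \<mu> * (2 - exp (- \<mu>)) *
    (a2 / \<mu> * exp \<mu> * (2 / (a1 / \<mu>)) - 1)"
proof -
  have "exp (- \<mu> * (p1 + p2 - 2)) = exp (- \<mu> * (p1 + p2)) * exp \<mu> * exp \<mu>"
    by (simp add: algebra_simps flip: exp_add)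
  moreover have "2 * (a2 / a1) * exp \<mu> - exp (- \<mu>) * exp \<mu> = a2 / \<mu> * exp \<mu> * (2 / (a1 / \<mu>)) - 1"
    using assms by (simp flip: exp_add)
  ultimately show ?thesis unfolding slope_def by algebra
qed

text \<open>Centred at \<open>- a1 / \<mu>\<close>, the map has the same constant term as
  \<open>x_return\<close>, so smoothing changes only the slope.\<close>

lemma return_map_affine:
  assumes "a1 > 0"
  shows "return_map \<mu> a1 a2 p1 p2 h = slope \<mu> a1 a2 p1 p2 * (h + a1 / \<mu>)
     + (a1 - a2) / \<mu> * exp (- \<mu> * p2) - a2 / \<mu>"
proof -
  have "(2 * a2 - a1 * exp (- \<mu>)) / \<mu> = (2 * (a2 / a1) - exp (- \<mu>)) * (a1 / \<mu>)"
    using assms by (simp add: left_diff_distrib)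
  then show ?thesis
    unfolding return_map_def offset_def slope_def by algebra
qed

lemma slope_error_bound_tendsto:
  assumes "\<mu> > 0" "a1 > 0"
  shows "(slope_error_bound \<mu> a1 a2 p1 p2 \<longlongrightarrow> 0) (nhds 0)"
proof -
  have "(slope_error_bound \<mu> a1 a2 p1 p2 \<longlongrightarrow> slope_error_bound \<mu> a1 a2 p1 p2 0) (nhds 0)"
    unfolding slope_error_bound_def using assms by (intro tendsto_intros filterlim_ident) auto
  then show ?thesis by (simp add: slope_error_bound_def)
qed

subsection \<open>Orbits of the smoothed equation\<close>

text \<open>\<open>h\<close> is arbitrary rather than a fixed point, since the return map has to be
  computed on a whole neighbourhood. The constant initial function represents all admissible ones
  with value \<open>h\<close> at 0.\<close>

locale smoothed_orbit =
  fixes \<mu> a1 a2 p1 p2 \<delta> \<rho> h :: real and f a x :: "real \<Rightarrow> real"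
  assumes pos: "\<mu> > 0" "a1 > 0" "a2 > 0" "\<delta> > 0" "\<rho> > 0"
    and feedback: "smoothed_feedback \<mu> a1 \<delta> f"
    and coefficient: "smoothed_coefficient \<mu> a1 a2 p1 p2 \<rho> a"
    and nondeg: "nondegenerate \<mu> a1 a2 p1 p2 h \<delta> \<rho>"
    and ivp: "solves_ivp \<mu> a f (\<lambda>_. h) x"
begin

definition "A = a1 / \<mu>"
definition "B = a2 / \<mu>"
definition "K = h + A"
definition "C = rise_amplitude \<mu> a1 h"
definition "\<tau> = crossing \<mu> K (A + \<delta>)"
definition "\<tau>' = crossing \<mu> K (A - \<delta>)"
definition "\<sigma> = crossing \<mu> C (A + \<delta>)"
definition "\<sigma>' = crossing \<mu> C (A - \<delta>)"
definition "Y t = exp (\<mu> * t) * x t"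
definition "Q t = integral {0..t} (\<lambda>s. a s * exp (\<mu> * s))"
text \<open>\<open>w\<close> is the value towards which the exponential piece of the orbit tends:
  \<open>- A\<close> in the fall, \<open>A\<close> in the rise. The integral vanishes at
  \<open>v = - \<delta>\<close>.\<close>

definition "transit_integral w v = integral {-\<delta>..v} (\<lambda>u. f u / (w - u)\<^sup>2)"

lemma nondeg_unfolded:
  "0 < K" "\<delta> < A" "\<rho> < \<tau>" "\<tau>' < \<tau> + 1"
  "A + \<delta> < (A - \<delta>) * (2 * A / (A + \<delta>) - exp (- \<mu>))"
  "\<tau>' + 1 < \<sigma>" "\<sigma>' < p1" "p1 + \<rho> < \<sigma> + 1" "\<sigma>' + 1 < p1 + p2"
  "\<delta> < exp (- \<mu>) * (A - C * exp (- \<mu> * p1))"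
  "\<delta> * exp (\<mu> * (p1 + p2)) <
     C * (2 * B * exp \<mu> / (A + \<delta>) - 1) + (A - B) * exp (\<mu> * p1) - B * exp (\<mu> * (p1 + p2))"
  using nondeg by (auto simp: nondegenerate_def Let_def A_def B_def K_def C_def \<tau>_def \<tau>'_def \<sigma>_def \<sigma>'_def)

lemma AB_pos: "A > 0" "B > 0"
  using pos by (auto simp: A_def B_def)

lemma C_eq: "C = K * exp \<mu> * (2 - exp (- \<mu>))"
  by (simp add: C_def K_def A_def rise_amplitude_def)

lemma C_pos: "C > 0"
  using nondeg_unfolded(1) pos(1) unfolding C_eq
  by (intro mult_pos_pos) (auto intro: less_trans[of _ 1])

lemmas falls = exp_crossing[OF pos(1) nondeg_unfolded(1)] le_crossing_iff[OF pos(1) nondeg_unfolded(1)]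
  crossing_le_iff[OF pos(1) nondeg_unfolded(1)]
lemmas rises = exp_crossing[OF pos(1) C_pos] le_crossing_iff[OF pos(1) C_pos]
  crossing_le_iff[OF pos(1) C_pos]

lemma
  shows exp_\<tau>: "exp (\<mu> * \<tau>) = K / (A + \<delta>)" and exp_\<tau>': "exp (\<mu> * \<tau>') = K / (A - \<delta>)"
    and exp_\<sigma>: "exp (\<mu> * \<sigma>) = C / (A + \<delta>)" and exp_\<sigma>': "exp (\<mu> * \<sigma>') = C / (A - \<delta>)"
    and le_\<tau>: "t \<le> \<tau> \<longleftrightarrow> (A + \<delta>) * exp (\<mu> * t) \<le> K" and \<tau>'_le: "\<tau>' \<le> t \<longleftrightarrow> K \<le> (A - \<delta>) * exp (\<mu> * t)"
    and \<tau>_le: "\<tau> \<le> t \<longleftrightarrow> K \<le> (A + \<delta>) * exp (\<mu> * t)" and le_\<tau>': "t \<le> \<tau>' \<longleftrightarrow> (A - \<delta>) * exp (\<mu> * t) \<le> K"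
    and le_\<sigma>: "t \<le> \<sigma> \<longleftrightarrow> (A + \<delta>) * exp (\<mu> * t) \<le> C" and \<sigma>'_le: "\<sigma>' \<le> t \<longleftrightarrow> C \<le> (A - \<delta>) * exp (\<mu> * t)"
    and \<sigma>_le: "\<sigma> \<le> t \<longleftrightarrow> C \<le> (A + \<delta>) * exp (\<mu> * t)" and le_\<sigma>': "t \<le> \<sigma>' \<longleftrightarrow> (A - \<delta>) * exp (\<mu> * t) \<le> C"
  using nondeg_unfolded(2) pos(4) AB_pos(1)
  unfolding \<tau>_def \<tau>'_def \<sigma>_def \<sigma>'_def by (simp_all add: falls rises)

lemma crossing_order: "0 < \<tau>" "\<tau> < \<tau>'" "\<sigma> < \<sigma>'"
proof -
  show "0 < \<tau>" using nondeg_unfolded(3) pos by linarith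
  have "(A - \<delta>) * exp (\<mu> * \<tau>) < (A + \<delta>) * exp (\<mu> * \<tau>)" using pos by simp
  also have "\<dots> \<le> K" using le_\<tau>[of \<tau>] by simp
  finally have "\<not> \<tau>' \<le> \<tau>" by (simp only: \<tau>'_le not_le)
  then show "\<tau> < \<tau>'" by simp
  have "(A - \<delta>) * exp (\<mu> * \<sigma>) < (A + \<delta>) * exp (\<mu> * \<sigma>)" using pos by simp
  also have "\<dots> \<le> C" using le_\<sigma>[of \<sigma>] by simp
  finally have "\<not> \<sigma>' \<le> \<sigma>" by (simp only: \<sigma>'_le not_le)
  then show "\<sigma> < \<sigma>'" by simp
qed

lemmas time_order = crossing_order nondeg_unfolded(3,4,6-9) pos(5)

lemma
  shows cont_f: "continuous_on S f" and cont_a: "continuous_on S a"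
    and f_pos: "u \<ge> \<delta> \<Longrightarrow> f u = -1" and f_neg: "u \<le> -\<delta> \<Longrightarrow> f u = 1"
    and f_bounds: "-1 \<le> f u" "f u \<le> 1"
proof -
  show "continuous_on S f" "continuous_on S a"
    using feedback coefficient
    by (auto simp: smoothed_feedback_def smoothed_coefficient_def intro: C_infinity_continuous_on)
  show p: "u \<ge> \<delta> \<Longrightarrow> f u = -1" and n: "u \<le> -\<delta> \<Longrightarrow> f u = 1"
    using feedback pos by (auto simp: smoothed_feedback_def)
  have "-1 \<le> f u \<and> f u \<le> 1" if "\<bar>u\<bar> \<le> \<delta>"
    using feedback that by (auto simp: smoothed_feedback_def)
  moreover have "\<bar>u\<bar> \<le> \<delta> \<or> u \<ge> \<delta> \<or> u \<le> -\<delta>" by linarith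
  ultimately have "-1 \<le> f u \<and> f u \<le> 1"
    using p n by fastforce
  then show "-1 \<le> f u" "f u \<le> 1" by simp_all
qed

lemma
  shows a_period: "a (t + (p1 + p2)) = a t"
    and a_first: "t \<in> {\<rho>..p1} \<Longrightarrow> a t = a1"
    and a_second: "t \<in> {p1 + \<rho>..p1 + p2} \<Longrightarrow> a t = a2"
    and a_pos: "t \<in> {0..p1 + p2} \<Longrightarrow> a t > 0"
proof -
  show "a (t + (p1 + p2)) = a t"
    and 1: "t \<in> {\<rho>..p1} \<Longrightarrow> a t = a1"
    and 2: "t \<in> {p1 + \<rho>..p1 + p2} \<Longrightarrow> a t = a2"
    using coefficient unfolding smoothed_coefficient_def by blast+
  have "a t > 0" if "t \<in> {0..\<rho>} \<union> {p1..p1 + \<rho>}"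
    using coefficient that unfolding smoothed_coefficient_def by blast
  then show "a t > 0" if "t \<in> {0..p1 + p2}"
    using 1 2 pos that by (cases "t \<le> \<rho>"; cases "t \<le> p1"; cases "t \<le> p1 + \<rho>") auto
qed

lemma
  shows x_init: "t \<in> {-1..0} \<Longrightarrow> x t = h"
    and cont_x: "S \<subseteq> {-1..} \<Longrightarrow> continuous_on S x"
    and deriv_x: "t > 0 \<Longrightarrow> (x has_real_derivative (- \<mu> * x t + a t * f (x (t - 1)))) (at t)"
proof -
  show "t \<in> {-1..0} \<Longrightarrow> x t = h" using ivp by (auto simp: solves_ivp_def)
  show "S \<subseteq> {-1..} \<Longrightarrow> continuous_on S x"
    using ivp by (auto simp: solves_ivp_def intro: continuous_on_subset)
  assume "t > 0"
  moreover from this have "at t within {0..} = at t" by (intro at_within_interior) auto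
  moreover have "(x has_real_derivative (- \<mu> * x t + a t * f (x (t - 1)))) (at t within {0..})"
    using ivp \<open>t > 0\<close> by (auto simp: solves_ivp_def)
  ultimately show "(x has_real_derivative (- \<mu> * x t + a t * f (x (t - 1)))) (at t)" by simp
qed

section \<open>The weighted orbit \<open>Y\<close> and the weighted coefficient integral
  \<open>Q\<close>\<close>

lemma deriv_Y: "t > 0 \<Longrightarrow> (Y has_real_derivative (a t * exp (\<mu> * t) * f (x (t - 1)))) (at t)"
  unfolding Y_def by (rule derivative_eq_intros deriv_x refl | simp)+ (simp add: algebra_simps)

lemma cont_Y: "S \<subseteq> {-1..} \<Longrightarrow> continuous_on S Y"
  unfolding Y_def by (intro continuous_intros cont_x)

lemma Y_0: "Y 0 = h"
  by (simp add: Y_def x_init)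

lemma x_ge_iff: "c \<le> x t \<longleftrightarrow> c * exp (\<mu> * t) \<le> Y t"
  and x_le_iff: "x t \<le> c \<longleftrightarrow> Y t \<le> c * exp (\<mu> * t)"
  by (simp_all add: Y_def mult.commute)

lemma cont_weighted_a: "continuous_on S (\<lambda>s. a s * exp (\<mu> * s))"
  by (intro continuous_intros cont_a)

lemma Q_add: "0 \<le> u \<Longrightarrow> u \<le> v \<Longrightarrow> Q v = Q u + integral {u..v} (\<lambda>s. a s * exp (\<mu> * s))"
  unfolding Q_def
  by (subst Henstock_Kurzweil_Integration.integral_combine)
     (auto intro!: integrable_continuous_interval cont_weighted_a)

lemma deriv_Q:
  assumes "t > 0"
  shows "(Q has_real_derivative (a t * exp (\<mu> * t))) (at t)"
proof -
  have "(Q has_real_derivative (a t * exp (\<mu> * t))) (at t within {0..t + 1})"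
    unfolding Q_def using assms
    by (intro integral_has_real_derivative cont_weighted_a) auto
  moreover have "at t within {0..t + 1} = at t"
    using assms by (intro at_within_interior) auto
  ultimately show ?thesis by simp
qed

lemma cont_Q:
  assumes "0 \<le> u"
  shows "continuous_on {u..v} Q"
proof -
  have "continuous_on {0..v} Q"
    unfolding Q_def
    by (intro indefinite_integral_continuous_1 integrable_continuous_interval cont_weighted_a)
  then show ?thesis by (rule continuous_on_subset) (use assms in auto)
qed

lemma Q_mono:
  assumes "0 \<le> u" "u \<le> v" "v \<le> p1 + p2"
  shows "Q u \<le> Q v"
proof (rule DERIV_nonneg_imp_increasing_open[of u v Q])
  show "\<exists>y. (Q has_real_derivative y) (at s) \<and> 0 \<le> y" if "u < s" "s < v" for s
    using that assms deriv_Q[of s] a_pos[of s] by (intro exI[of _ "a s * exp (\<mu> * s)"] conjI) auto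
qed (use assms in \<open>auto intro: cont_Q\<close>)

lemma Q_constant:
  assumes "0 \<le> u" "u \<le> v" "\<And>s. s \<in> {u..v} \<Longrightarrow> a s = c"
  shows "Q v = Q u + c / \<mu> * (exp (\<mu> * v) - exp (\<mu> * u))"
proof -
  have "integral {u..v} (\<lambda>s. a s * exp (\<mu> * s)) = integral {u..v} (\<lambda>s. c * exp (\<mu> * s))"
    using assms by (intro integral_cong) auto
  then show ?thesis
    using Q_add[of u v] assms pos by (simp add: integral_exp_linear)
qed

text \<open>The integral condition on \<open>[0, \<rho>]\<close> gives \<open>Q \<rho>\<close> the
  value it would have if the coefficient were \<open>a1\<close> from 0 on. \<open>Q_second\<close>
  repeats this at \<open>p1\<close> with \<open>a2\<close>.\<close>

lemma Q_first:
  assumes "\<rho> \<le> t" "t \<le> p1"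
  shows "Q t = A * (exp (\<mu> * t) - 1)"
proof -
  have "Q \<rho> = A * (exp (\<mu> * \<rho>) - 1)"
    using coefficient pos by (simp add: smoothed_coefficient_def Q_def integral_exp_linear A_def)
  moreover have "Q t = Q \<rho> + a1 / \<mu> * (exp (\<mu> * t) - exp (\<mu> * \<rho>))"
    using assms pos a_first by (intro Q_constant) auto
  ultimately show ?thesis by (simp add: A_def algebra_simps)
qed

lemma Q_second:
  assumes "p1 + \<rho> \<le> t" "t \<le> p1 + p2"
  shows "Q t = A * (exp (\<mu> * p1) - 1) + B * (exp (\<mu> * t) - exp (\<mu> * p1))"
proof -
  have "Q p1 = A * (exp (\<mu> * p1) - 1)"
    using time_order by (intro Q_first) auto
  moreover have "Q (p1 + \<rho>) = Q p1 + B * (exp (\<mu> * (p1 + \<rho>)) - exp (\<mu> * p1))"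
    using coefficient pos time_order
    by (simp add: Q_add[of p1 "p1 + \<rho>"] smoothed_coefficient_def integral_exp_linear B_def)
  moreover have "Q t = Q (p1 + \<rho>) + a2 / \<mu> * (exp (\<mu> * t) - exp (\<mu> * (p1 + \<rho>)))"
    using assms pos time_order a_second by (intro Q_constant) auto
  ultimately show ?thesis by (simp add: B_def algebra_simps)
qed

section \<open>Evolution under constant feedback and through a transition\<close>

lemma constant_feedback:
  assumes "0 \<le> u" "u \<le> v" "\<And>s. u < s \<Longrightarrow> s < v \<Longrightarrow> f (x (s - 1)) = c"
  shows "Y v = Y u + c * (Q v - Q u)"
proof (cases "u = v")
  case False
  have "Y v - c * Q v = Y u - c * Q u"
  proof (rule DERIV_isconst_end[of u v "\<lambda>t. Y t - c * Q t"])
    show "continuous_on {u..v} (\<lambda>t. Y t - c * Q t)"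
      using assms by (intro continuous_intros cont_Y cont_Q) auto
    show "((\<lambda>t. Y t - c * Q t) has_real_derivative 0) (at s)" if "u < s" "s < v" for s
      using assms that by (auto intro!: derivative_eq_intros deriv_Y deriv_Q)
  qed (use assms False in auto)
  then show ?thesis by (simp add: algebra_simps)
qed simp

text \<open>Method of steps: the formula up to a time gives, by \<open>persist\<close>, the feedback
  one unit later, and so the formula there. Hence \<open>persist\<close> may presuppose the formula,
  and validity reaches one delay beyond \<open>v\<close>.\<close>

lemma persistent_feedback:
  assumes "0 \<le> u" and before: "\<And>s. s \<in> {u - 1..u} \<Longrightarrow> f (x s) = c"
    and persist: "\<And>t. t \<in> {u..v} \<Longrightarrow> Y t = Y u + c * (Q t - Q u) \<Longrightarrow> f (x t) = c"
    and "t \<in> {u..v + 1}"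
  shows "Y t = Y u + c * (Q t - Q u)"
proof -
  have "\<forall>t\<in>{u..v + 1}. t \<le> u + real n \<longrightarrow> Y t = Y u + c * (Q t - Q u)" for n
  proof (induction n)
    case 0
    have "t = u" if "t \<in> {u..v + 1}" "t \<le> u + real 0" for t using that by simp
    then show ?case by (metis diff_self mult_zero_right add_0_right)
  next
    case (Suc n)
    show ?case
    proof (intro ballI impI)
      fix t
      assume t: "t \<in> {u..v + 1}" "t \<le> u + real (Suc n)"
      show "Y t = Y u + c * (Q t - Q u)"
      proof (rule constant_feedback)
        fix s assume s: "u < s" "s < t"
        show "f (x (s - 1)) = c"
        proof (cases "s - 1 \<le> u")
          case True
          then show ?thesis using s by (intro before) simp
        next
          case False
          then have *: "s - 1 \<in> {u..v}" "s - 1 \<le> u + real n" using s t by auto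
          moreover from * have "Y (s - 1) = Y u + c * (Q (s - 1) - Q u)"
            by (intro Suc[rule_format]) auto
          ultimately show ?thesis by (intro persist)
        qed
      qed (use assms(1) t in auto)
    qed
  qed
  moreover obtain n where "t - u \<le> real n" using real_arch_simple by blast
  then have "t \<le> u + real n" by simp
  ultimately show ?thesis using assms(4) by blast
qed

text \<open>As \<open>-1 \<le> f \<le> 1\<close> and \<open>a > 0\<close>, the derivative of
  \<open>Y\<close> lies between minus and plus that of \<open>Q\<close>. This controls the orbit
  during the transitions, where it has no explicit formula.\<close>

lemma
  assumes "0 \<le> u" "u \<le> v" "v \<le> p1 + p2"
  shows Y_plus_Q_mono: "Y u + Q u \<le> Y v + Q v"
    and Y_minus_Q_antimono: "Y v - Q v \<le> Y u - Q u"
proof -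
  have "(\<lambda>t. Y t + Q t) u \<le> (\<lambda>t. Y t + Q t) v"
  proof (rule DERIV_nonneg_imp_increasing_open[OF assms(2)])
    fix s assume s: "u < s" "s < v"
    show "\<exists>y. ((\<lambda>t. Y t + Q t) has_real_derivative y) (at s) \<and> 0 \<le> y"
    proof (intro exI conjI)
      show "((\<lambda>t. Y t + Q t) has_real_derivative (a s * exp (\<mu> * s) * (1 + f (x (s - 1))))) (at s)"
        using assms s by (auto intro!: derivative_eq_intros deriv_Y deriv_Q simp: algebra_simps)
      show "0 \<le> a s * exp (\<mu> * s) * (1 + f (x (s - 1)))"
        using assms s a_pos[of s] f_bounds(1)[of "x (s - 1)"]
        by (intro mult_nonneg_nonneg) auto
    qed
  qed (use assms in \<open>auto intro!: continuous_intros cont_Y cont_Q\<close>)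
  then show "Y u + Q u \<le> Y v + Q v" by simp
  have "(\<lambda>t. Q t - Y t) u \<le> (\<lambda>t. Q t - Y t) v"
  proof (rule DERIV_nonneg_imp_increasing_open[OF assms(2)])
    fix s assume s: "u < s" "s < v"
    show "\<exists>y. ((\<lambda>t. Q t - Y t) has_real_derivative y) (at s) \<and> 0 \<le> y"
    proof (intro exI conjI)
      show "((\<lambda>t. Q t - Y t) has_real_derivative (a s * exp (\<mu> * s) * (1 - f (x (s - 1))))) (at s)"
        using assms s by (auto intro!: derivative_eq_intros deriv_Y deriv_Q simp: algebra_simps)
      show "0 \<le> a s * exp (\<mu> * s) * (1 - f (x (s - 1)))"
        using assms s a_pos[of s] f_bounds(2)[of "x (s - 1)"]
        by (intro mult_nonneg_nonneg) auto
    qed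
  qed (use assms in \<open>auto intro!: continuous_intros cont_Y cont_Q\<close>)
  then show "Y v - Q v \<le> Y u - Q u" by simp
qed

lemma cont_transit_integrand: "\<delta> < \<bar>w\<bar> \<Longrightarrow> continuous_on {-\<delta>..\<delta>} (\<lambda>u. f u / (w - u)\<^sup>2)"
  by (intro continuous_intros cont_f) (auto simp: abs_if split: if_splits)

text \<open>
  If \<open>x\<close> follows \<open>w - k * exp (- \<mu> * s)\<close>, then \<open>\<mu> * exp (\<mu> * s) / k\<close> is the derivative of \<open>x\<close> at
  \<open>s\<close> over \<open>(w - x s)\<^sup>2\<close>: this replaces the substitution rule for integrals.
\<close>

lemma transit:
  assumes "0 \<le> u" "u < v" "k \<noteq> 0" "\<delta> < \<bar>w\<bar>"
    and x_eq: "\<And>s. s \<in> {u..v} \<Longrightarrow> Y s = w * exp (\<mu> * s) - k"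
    and x_closed: "\<And>s. s \<in> {u..v} \<Longrightarrow> x s \<in> {-\<delta>..\<delta>}"
    and x_open: "\<And>s. s \<in> {u<..<v} \<Longrightarrow> x s \<in> {-\<delta><..<\<delta>}"
    and a_eq: "\<And>s. s \<in> {u + 1..v + 1} \<Longrightarrow> a s = c"
  shows "Y (v + 1) = Y (u + 1) + c * k * exp \<mu> / \<mu> * (transit_integral w (x v) - transit_integral w (x u))"
proof -
  \<comment> \<open>The claim is that \<open>G\<close> takes the same value at both ends.\<close>
  define G where "G t = Y t - c * k * exp \<mu> / \<mu> * transit_integral w (x (t - 1))" for t
  have "G (v + 1) = G (u + 1)"
  proof (rule DERIV_isconst_end[where f = G])
    have "continuous_on {-\<delta>..\<delta>} (transit_integral w)"
      unfolding transit_integral_def using assms(4)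
      by (intro indefinite_integral_continuous_1 integrable_continuous_interval cont_transit_integrand)
    moreover have "continuous_on {u + 1..v + 1} (\<lambda>t. x (t - 1))"
      using assms(1)
      by (intro continuous_on_compose2[OF cont_x[OF order_refl]] continuous_intros) auto
    ultimately have "continuous_on {u + 1..v + 1} (\<lambda>t. transit_integral w (x (t - 1)))"
      by (rule continuous_on_compose2) (use x_closed in auto)
    then show "continuous_on {u + 1..v + 1} G"
      unfolding G_def using assms(1) by (intro continuous_intros cont_Y) auto
    fix t assume t: "u + 1 < t" "t < v + 1"
    define s where "s = t - 1"
    have s: "s \<in> {u<..<v}" "s > 0" using t assms(1) by (auto simp: s_def)
    have ws: "w - x s = k * exp (- (\<mu> * s))"
      using x_eq[of s] s by (simp add: Y_def exp_minus field_simps)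
    \<comment> \<open>The derivative of the explicit \<open>Y\<close> is compared with the equation;
      this identifies the feedback term at \<open>s\<close> without evaluating
      \<open>f (x (s - 1))\<close>.\<close>
    have "\<mu> * (w - x s) = - \<mu> * x s + a s * f (x (s - 1))"
    proof -
      have "((\<lambda>r. w * exp (\<mu> * r) - k) has_real_derivative (w * \<mu> * exp (\<mu> * s))) (at s)"
        by (auto intro!: derivative_eq_intros)
      then have "(Y has_real_derivative (w * \<mu> * exp (\<mu> * s))) (at s)"
        by (rule has_field_derivative_transform_within_open[where S = "{u<..<v}"])
           (use s x_eq in auto)
      with deriv_Y[OF s(2)] have "a s * exp (\<mu> * s) * f (x (s - 1)) = w * \<mu> * exp (\<mu> * s)"
        by (rule DERIV_unique)
      then show ?thesis by (simp add: algebra_simps)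
    qed
    then have "(x has_real_derivative (\<mu> * (w - x s))) (at s)"
      using deriv_x[OF s(2)] by simp
    then have dx: "((\<lambda>t. x (t - 1)) has_real_derivative (\<mu> * (w - x s))) (at t)"
      unfolding s_def by (subst DERIV_shift[of x _ t "-1", simplified, symmetric]) auto
    have "(transit_integral w has_real_derivative (f (x s) / (w - x s)\<^sup>2)) (at (x s) within {-\<delta>..\<delta>})"
      unfolding transit_integral_def
      using x_closed[of s] s assms(4) by (intro integral_has_real_derivative cont_transit_integrand) auto
    \<comment> \<open>The open condition on \<open>x s\<close> turns the derivative within
      \<open>[-\<delta>, \<delta>]\<close> into a two-sided one, as the chain rule requires.\<close>
    moreover have "at (x s) within {-\<delta>..\<delta>} = at (x s)"
      using x_open[of s] s by (intro at_within_interior) auto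
    ultimately have "(transit_integral w has_real_derivative (f (x s) / (w - x s)\<^sup>2)) (at (x (t - 1)))"
      by (simp add: s_def)
    from DERIV_chain2[OF this dx]
    have "((\<lambda>t. transit_integral w (x (t - 1))) has_real_derivative
        (f (x s) / (w - x s)\<^sup>2 * (\<mu> * (w - x s)))) (at t)" .
    moreover have "f (x s) / (w - x s)\<^sup>2 * (\<mu> * (w - x s)) = \<mu> * f (x s) * exp (\<mu> * s) / k"
      using assms(3) by (simp add: ws power2_eq_square exp_minus field_simps)
    ultimately have dT: "((\<lambda>t. transit_integral w (x (t - 1))) has_real_derivative
        (\<mu> * f (x s) * exp (\<mu> * s) / k)) (at t)" by simp
    have "exp (\<mu> * t) = exp \<mu> * exp (\<mu> * s)"
      by (simp add: s_def algebra_simps flip: exp_add)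
    moreover have "a t = c" using a_eq t by auto
    ultimately have "a t * exp (\<mu> * t) * f (x (t - 1)) -
        c * k * exp \<mu> / \<mu> * (\<mu> * f (x s) * exp (\<mu> * s) / k) = 0"
      using assms(3) pos(1) by (simp add: s_def)
    moreover have "t > 0" using t assms(1) by simp
    ultimately show "(G has_real_derivative 0) (at t)"
      unfolding G_def using DERIV_diff[OF deriv_Y DERIV_cmult[OF dT]] by metis
  qed (use assms in auto)
  then show ?thesis by (simp add: G_def algebra_simps)
qed

section \<open>The fall and the first transition\<close>

lemma h_ge: "\<delta> \<le> h"
  using le_\<tau>[of 0] time_order(1) by (simp add: K_def)

text \<open>From \<open>\<rho>\<close> on this is the definition of \<open>\<tau>\<close>. Before
  \<open>\<rho>\<close>, \<open>Q\<close> is only known to be monotone; the bound at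
  \<open>\<rho>\<close> carries back because \<open>\<delta> * exp (\<mu> * t) + Q t\<close>
  increases.\<close>

lemma fall_lower_bound:
  assumes "t \<in> {0..\<tau>}"
  shows "\<delta> * exp (\<mu> * t) \<le> h - Q t"
proof -
  have *: "\<delta> * exp (\<mu> * s) \<le> h - Q s" if "\<rho> \<le> s" "s \<le> \<tau>" for s
    using that time_order le_\<tau>[of s] Q_first[of s] by (simp add: K_def algebra_simps)
  show ?thesis
  proof (cases "\<rho> \<le> t")
    case True
    then show ?thesis using * assms by auto
  next
    case False
    have "\<delta> * exp (\<mu> * t) \<le> \<delta> * exp (\<mu> * \<rho>)" using False pos by simp
    also have "\<dots> \<le> h - Q \<rho>" using * time_order by auto
    also have "\<dots> \<le> h - Q t" using False assms time_order Q_mono[of t \<rho>] by auto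
    finally show ?thesis .
  qed
qed

lemma Y_fall:
  assumes "t \<in> {0..\<tau> + 1}"
  shows "Y t = h - Q t"
proof -
  have Q0: "Q 0 = 0" by (simp add: Q_def)
  have "Y t = Y 0 + (- 1) * (Q t - Q 0)"
  proof (rule persistent_feedback[OF _ _ _ assms])
    show "f (x s) = - 1" if "s \<in> {0 - 1..0}" for s
      using that h_ge by (simp add: x_init f_pos)
    show "f (x s) = - 1" if "s \<in> {0..\<tau>}" "Y s = Y 0 + - 1 * (Q s - Q 0)" for s
      using fall_lower_bound[OF that(1)] that(2) by (intro f_pos) (simp add: x_ge_iff Y_0 Q0)
  qed simp
  then show ?thesis by (simp add: Q0 Y_0)
qed

lemma x_ge_start: "t \<in> {0..\<tau>} \<Longrightarrow> \<delta> \<le> x t"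
  using fall_lower_bound[of t] Y_fall[of t] by (simp add: x_ge_iff)

lemma Y_fall_explicit: "t \<in> {\<rho>..\<tau> + 1} \<Longrightarrow> Y t = K - A * exp (\<mu> * t)"
  using Y_fall[of t] Q_first[of t] time_order by (simp add: K_def algebra_simps)

lemma
  assumes "t \<in> {\<rho>..\<tau> + 1}"
  shows fall_ge_pos: "\<delta> \<le> x t \<longleftrightarrow> t \<le> \<tau>" and fall_le_pos: "x t \<le> \<delta> \<longleftrightarrow> \<tau> \<le> t"
    and fall_ge_neg: "- \<delta> \<le> x t \<longleftrightarrow> t \<le> \<tau>'" and fall_le_neg: "x t \<le> - \<delta> \<longleftrightarrow> \<tau>' \<le> t"
  using Y_fall_explicit[OF assms]
  by (auto simp: x_ge_iff x_le_iff le_\<tau> \<tau>_le le_\<tau>' \<tau>'_le algebra_simps)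

text \<open>Here the integral condition on \<open>f\<close> enters, with pole
  \<open>- A\<close>.\<close>

lemma transit_integral_fall: "transit_integral (- A) \<delta> = 1 / (A - \<delta>) + 1 / (A + \<delta>) - 2 / A"
  using feedback integral_neg_sgn_over_square[OF pos(4) nondeg_unfolded(2)]
  by (simp add: smoothed_feedback_def Let_def transit_integral_def A_def)

text \<open>The term with \<open>1 / (A + \<delta>)\<close> in \<open>Y (\<tau> + 1)\<close> cancels
  against the transit integral, and the one with \<open>1 / (A - \<delta>)\<close> is absorbed in
  \<open>exp (\<mu> * (\<tau>' + 1))\<close>. The constant \<open>C\<close> that remains does not
  depend on \<open>\<delta>\<close>.\<close>

lemma Y_fall_end: "Y (\<tau>' + 1) = A * exp (\<mu> * (\<tau>' + 1)) - C"
proof -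
  have "x \<tau> = \<delta>" "x \<tau>' = - \<delta>"
    using time_order by (auto intro!: antisym simp: fall_ge_pos fall_le_pos fall_ge_neg fall_le_neg)
  have "Y (\<tau>' + 1) = Y (\<tau> + 1) + a1 * (- K) * exp \<mu> / \<mu> *
      (transit_integral (- A) (x \<tau>') - transit_integral (- A) (x \<tau>))"
  proof (rule transit)
    show "x s \<in> {-\<delta>..\<delta>}" if "s \<in> {\<tau>..\<tau>'}" for s
      using that time_order by (simp add: fall_le_pos fall_ge_neg)
    show "x s \<in> {-\<delta><..<\<delta>}" if "s \<in> {\<tau><..<\<tau>'}" for s
      using that time_order fall_ge_pos[of s] fall_le_neg[of s] by auto
    show "a s = a1" if "s \<in> {\<tau> + 1..\<tau>' + 1}" for s
      using that time_order by (intro a_first) auto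
  qed (use time_order nondeg_unfolded(1,2) AB_pos Y_fall_explicit in auto)
  \<comment> \<open>\<open>transit\<close> was applied with \<open>k = - K\<close>; since the orbit
    runs from \<open>\<delta>\<close> down to \<open>- \<delta>\<close>, where the integral
    vanishes, the signs cancel.\<close>
  also have "\<dots> = Y (\<tau> + 1) + A * K * exp \<mu> * transit_integral (- A) \<delta>"
    by (simp add: \<open>x \<tau> = \<delta>\<close> \<open>x \<tau>' = - \<delta>\<close> A_def) (simp add: transit_integral_def)
  also have "Y (\<tau> + 1) = K - A * exp (\<mu> * (\<tau> + 1))"
    using time_order by (intro Y_fall_explicit) auto
  also have "exp (\<mu> * (\<tau> + 1)) = exp \<mu> * (K / (A + \<delta>))"
    by (simp add: distrib_left exp_add exp_\<tau>)
  finally have "Y (\<tau>' + 1) = A * (exp \<mu> * (K / (A - \<delta>))) - (K * exp \<mu> * 2 - K)"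
    using AB_pos by (simp add: transit_integral_fall algebra_simps)
  moreover have "exp (\<mu> * (\<tau>' + 1)) = exp \<mu> * (K / (A - \<delta>))"
    by (simp add: distrib_left exp_add exp_\<tau>')
  moreover have "C = K * exp \<mu> * 2 - K"
    by (simp add: C_eq algebra_simps exp_minus)
  ultimately show ?thesis by simp
qed

text \<open>During the transition \<open>Y\<close> cannot grow faster than \<open>Q\<close>. Even
  with feedback 1 from \<open>\<tau> + 1\<close> on, the orbit would stay below
  \<open>- \<delta>\<close> until \<open>\<tau>' + 1\<close>; this is the fifth inequality of
  \<open>nondeg_unfolded\<close>, multiplied out.\<close>

lemma x_le_bottom:
  assumes "t \<in> {\<tau> + 1..\<tau>' + 1}"
  shows "x t \<le> - \<delta>"
proof -
  have e: "exp (\<mu> * (\<tau> + 1)) = exp \<mu> * (K / (A + \<delta>))"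
    by (simp add: distrib_left exp_add exp_\<tau>)
  have "exp (\<mu> * t) \<le> exp (\<mu> * (\<tau>' + 1))" using assms pos by simp
  also have "\<dots> = exp \<mu> * (K / (A - \<delta>))"
    by (simp add: distrib_left exp_add exp_\<tau>')
  finally have "(A + \<delta>) * exp (\<mu> * t) \<le> (A + \<delta>) * (exp \<mu> * (K / (A - \<delta>)))"
    using AB_pos pos by (intro mult_left_mono) auto
  also have "\<dots> = (exp \<mu> * K / (A - \<delta>)) * (A + \<delta>)" by simp
  also have "\<dots> \<le> (exp \<mu> * K / (A - \<delta>)) * ((A - \<delta>) * (2 * A / (A + \<delta>) - exp (- \<mu>)))"
    using nondeg_unfolded(1,2,5) by (intro mult_left_mono) auto
  also have "\<dots> = exp \<mu> * K * (2 * A / (A + \<delta>) - exp (- \<mu>))"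
    using nondeg_unfolded(2) by simp
  also have "\<dots> = 2 * A * exp (\<mu> * (\<tau> + 1)) - exp \<mu> * exp (- \<mu>) * K"
    unfolding e by (simp add: algebra_simps)
  also have "\<dots> = 2 * A * exp (\<mu> * (\<tau> + 1)) - K"
    by (simp flip: exp_add)
  finally have *: "(A + \<delta>) * exp (\<mu> * t) \<le> 2 * A * exp (\<mu> * (\<tau> + 1)) - K" .
  have "Y t - Q t \<le> Y (\<tau> + 1) - Q (\<tau> + 1)"
    using assms time_order by (intro Y_minus_Q_antimono) auto
  moreover have "Q t = A * (exp (\<mu> * t) - 1)" "Q (\<tau> + 1) = A * (exp (\<mu> * (\<tau> + 1)) - 1)"
    using assms time_order by (auto intro!: Q_first)
  moreover have "Y (\<tau> + 1) = K - A * exp (\<mu> * (\<tau> + 1))"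
    using time_order by (intro Y_fall_explicit) auto
  ultimately show ?thesis using * by (simp add: x_le_iff algebra_simps)
qed

section \<open>The rise and the second transition\<close>

text \<open>Stated with \<open>Q\<close> because the interval passes \<open>p1\<close>, where the
  coefficient changes while the feedback is still 1.\<close>

lemma Y_rise:
  assumes "t \<in> {\<tau>' + 1..\<sigma> + 1}"
  shows "Y t = A - C + Q t"
proof -
  have Q0: "Y (\<tau>' + 1) - Q (\<tau>' + 1) = A - C"
    using Q_first[of "\<tau>' + 1"] time_order Y_fall_end by (simp add: algebra_simps)
  have "Y t = Y (\<tau>' + 1) + 1 * (Q t - Q (\<tau>' + 1))"
  proof (rule persistent_feedback[OF _ _ _ assms])
    \<comment> \<open>On \<open>[\<tau>', \<tau> + 1]\<close> the explicit fall gives the sign, on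
      the rest \<open>x_le_bottom\<close>.\<close>
    show "f (x s) = 1" if "s \<in> {\<tau>' + 1 - 1..\<tau>' + 1}" for s
      using that time_order x_le_bottom[of s] fall_le_neg[of s]
      by (intro f_neg) (cases "s \<le> \<tau> + 1"; simp)
    show "f (x s) = 1" if "s \<in> {\<tau>' + 1..\<sigma>}"
      and "Y s = Y (\<tau>' + 1) + 1 * (Q s - Q (\<tau>' + 1))" for s
      using that time_order Q0 Q_first[of s] le_\<sigma>[of s]
      by (intro f_neg) (simp add: x_le_iff algebra_simps)
  qed (use time_order in simp)
  then show ?thesis using Q0 by simp
qed

lemma Y_rise_explicit: "t \<in> {\<tau>' + 1..p1} \<Longrightarrow> Y t = A * exp (\<mu> * t) - C"
  using Y_rise[of t] Q_first[of t] time_order by (simp add: algebra_simps)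

lemma
  assumes "t \<in> {\<tau>' + 1..p1}"
  shows rise_ge_pos: "\<delta> \<le> x t \<longleftrightarrow> \<sigma>' \<le> t" and rise_le_pos: "x t \<le> \<delta> \<longleftrightarrow> t \<le> \<sigma>'"
    and rise_ge_neg: "- \<delta> \<le> x t \<longleftrightarrow> \<sigma> \<le> t" and rise_le_neg: "x t \<le> - \<delta> \<longleftrightarrow> t \<le> \<sigma>"
  using Y_rise_explicit[OF assms]
  by (auto simp: x_ge_iff x_le_iff le_\<sigma> \<sigma>_le le_\<sigma>' \<sigma>'_le algebra_simps)

text \<open>The transition takes place entirely where the coefficient is \<open>a2\<close>, since
  \<open>p1 + \<rho> < \<sigma> + 1\<close>. The integral with pole \<open>A\<close> is not
  prescribed and stays in the result.\<close>

lemma Y_rise_end: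
  "Y (\<sigma>' + 1) = Y (\<sigma> + 1) + B * C * exp \<mu> * transit_integral A \<delta>"
proof -
  have "x \<sigma> = - \<delta>" "x \<sigma>' = \<delta>"
    using time_order by (auto intro!: antisym simp: rise_ge_pos rise_le_pos rise_ge_neg rise_le_neg)
  have "Y (\<sigma>' + 1) = Y (\<sigma> + 1) + a2 * C * exp \<mu> / \<mu> *
      (transit_integral A (x \<sigma>') - transit_integral A (x \<sigma>))"
  proof (rule transit)
    show "x s \<in> {-\<delta>..\<delta>}" if "s \<in> {\<sigma>..\<sigma>'}" for s
      using that time_order by (simp add: rise_le_pos rise_ge_neg)
    show "x s \<in> {-\<delta><..<\<delta>}" if "s \<in> {\<sigma><..<\<sigma>'}" for s
      using that time_order rise_ge_pos[of s] rise_le_neg[of s] by auto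
    show "a s = a2" if "s \<in> {\<sigma> + 1..\<sigma>' + 1}" for s
      using that time_order by (intro a_second) auto
  qed (use time_order nondeg_unfolded(2) C_pos AB_pos Y_rise_explicit in auto)
  then show ?thesis
    by (simp add: \<open>x \<sigma> = - \<delta>\<close> \<open>x \<sigma>' = \<delta>\<close> B_def) (simp add: transit_integral_def)
qed

text \<open>It yields feedback -1 from \<open>\<sigma>' + 1\<close> to the end of the period, and a
  final segment of length 1 that is again an admissible initial function.\<close>

lemma x_ge_end:
  assumes "t \<in> {\<sigma>'..p1 + p2}"
  shows "\<delta> \<le> x t"
proof -
  consider "t \<le> p1" | "p1 \<le> t" "t \<le> \<sigma> + 1" | "\<sigma> + 1 \<le> t" by linarith
  then show ?thesis
  proof cases
    case 1
    then show ?thesis using assms time_order by (simp add: rise_ge_pos)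
  next
    case 2
    \<comment> \<open>Here \<open>t \<le> \<sigma> + 1 < p1 + 1\<close>; this one unit past
      \<open>p1\<close> is the origin of the factor \<open>exp (- \<mu>)\<close> in
      \<open>nondegenerate\<close>.\<close>
    have "\<delta> * exp (\<mu> * t) \<le> \<delta> * exp (\<mu> * (p1 + 1))"
      using 2 time_order pos by simp
    also have "\<dots> = (exp \<mu> * exp (\<mu> * p1)) * \<delta>" by (simp add: distrib_left exp_add)
    also have "\<dots> \<le> (exp \<mu> * exp (\<mu> * p1)) * (exp (- \<mu>) * (A - C * exp (- \<mu> * p1)))"
      using nondeg_unfolded(10) by (intro mult_left_mono) auto
    also have "\<dots> = A * exp (\<mu> * p1) - C" by (simp add: exp_minus field_simps)
    also have "\<dots> = Y p1" using Y_rise_explicit[of p1] time_order by simp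
    also have "\<dots> \<le> Y t"
      using 2 assms time_order Y_rise[of p1] Y_rise[of t] Q_mono[of p1 t] by simp
    finally show ?thesis by (simp add: x_ge_iff)
  next
    case 3
    have "\<delta> * exp (\<mu> * t) \<le> \<delta> * exp (\<mu> * (p1 + p2))"
      using assms pos by simp
    also have "\<dots> \<le> C * (2 * B * exp \<mu> / (A + \<delta>) - 1) + (A - B) * exp (\<mu> * p1) - B * exp (\<mu> * (p1 + p2))"
      using nondeg_unfolded(11) by simp
    also have "\<dots> = A - C + 2 * Q (\<sigma> + 1) - Q (p1 + p2)"
    proof -
      have "exp (\<mu> * (\<sigma> + 1)) = exp \<mu> * (C / (A + \<delta>))"
        by (simp add: distrib_left exp_add exp_\<sigma>)
      then show ?thesis
        using time_order by (simp add: Q_second algebra_simps)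
    qed
    also have "\<dots> = Y (\<sigma> + 1) + Q (\<sigma> + 1) - Q (p1 + p2)"
      using time_order by (simp add: Y_rise)
    \<comment> \<open>Worst case: feedback -1 from \<open>\<sigma> + 1\<close> up to the end of the
      period.\<close>
    also have "\<dots> \<le> Y t"
      using 3 assms time_order Y_plus_Q_mono[of "\<sigma> + 1" t] Q_mono[of t "p1 + p2"] by simp
    finally show ?thesis by (simp add: x_ge_iff)
  qed
qed

section \<open>The return value and its slope\<close>

text \<open>The crossing times enter only through their exponentials, which are multiples of
  \<open>C\<close> and hence of \<open>h + a1 / \<mu>\<close>; therefore the result is affine in
  \<open>h\<close>.\<close>

lemma x_return:
  "x (p1 + p2) = smoothed_slope \<mu> a1 a2 p1 p2 \<delta> f * (h + a1 / \<mu>)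
     + (a1 - a2) / \<mu> * exp (- \<mu> * p2) - a2 / \<mu>"
proof -
  have "Y (p1 + p2) = Y (\<sigma>' + 1) + (- 1) * (Q (p1 + p2) - Q (\<sigma>' + 1))"
  proof (rule constant_feedback)
    show "f (x (s - 1)) = - 1" if "\<sigma>' + 1 < s" "s < p1 + p2" for s
      using that by (intro f_pos x_ge_end) auto
  qed (use time_order in auto)
  moreover have "Y (\<sigma> + 1) = A - C + Q (\<sigma> + 1)"
    using time_order by (intro Y_rise) auto
  moreover have "exp (\<mu> * (\<sigma> + 1)) = exp \<mu> * (C / (A + \<delta>))"
    by (simp add: distrib_left exp_add exp_\<sigma>)
  moreover have "exp (\<mu> * (\<sigma>' + 1)) = exp \<mu> * (C / (A - \<delta>))"
    by (simp add: distrib_left exp_add exp_\<sigma>')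
  ultimately have "Y (p1 + p2) =
      C * (B * exp \<mu> * (1 / (A + \<delta>) + 1 / (A - \<delta>) + transit_integral A \<delta>) - 1)
      + (A - B) * exp (\<mu> * p1) - B * exp (\<mu> * (p1 + p2))"
    using time_order Y_rise_end by (simp add: Q_second algebra_simps)
  moreover have "x (p1 + p2) = exp (- \<mu> * (p1 + p2)) * Y (p1 + p2)"
    by (simp add: Y_def flip: exp_add mult.assoc)
  moreover have "exp (- \<mu> * (p1 + p2)) * exp (\<mu> * p1) = exp (- \<mu> * p2)"
    and "exp (- \<mu> * (p1 + p2)) * exp (\<mu> * (p1 + p2)) = 1"
    by (simp_all add: algebra_simps flip: exp_add)
  ultimately have "x (p1 + p2) = exp (- \<mu> * (p1 + p2)) *
      (C * (B * exp \<mu> * (1 / (A + \<delta>) + 1 / (A - \<delta>) + transit_integral A \<delta>) - 1))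
      + (A - B) * exp (- \<mu> * p2) - B"
    by algebra
  then show ?thesis
    by (simp add: smoothed_slope_def C_eq K_def A_def B_def transit_integral_def diff_divide_distrib mult_ac)
qed

lemma return_map_eq: "smoothed_return_map \<mu> a f \<delta> (p1 + p2) h = x (p1 + p2)"
  using h_ge time_order
  by (intro smoothed_return_map_eq[OF feedback pos(4) _ _ ivp]) (auto simp: admissible_initial_def)

lemma transit_integral_bound: "\<bar>transit_integral A \<delta>\<bar> \<le> 2 * \<delta> / (A - \<delta>)\<^sup>2"
proof -
  have "norm (transit_integral A \<delta>) \<le> 1 / (A - \<delta>)\<^sup>2 * (\<delta> - (-\<delta>))"
    unfolding transit_integral_def
  proof (rule integral_bound)
    show "continuous_on {-\<delta>..\<delta>} (\<lambda>u. f u / (A - u)\<^sup>2)"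
      using nondeg_unfolded(2) AB_pos by (intro cont_transit_integrand) auto
    fix u assume u: "u \<in> {-\<delta>..\<delta>}"
    have "\<bar>f u\<bar> \<le> 1" using f_bounds[of u] by auto
    moreover have "(A - \<delta>)\<^sup>2 \<le> (A - u)\<^sup>2"
      using u nondeg_unfolded(2) by (intro power_mono) auto
    moreover have "(A - \<delta>)\<^sup>2 > 0" using nondeg_unfolded(2) by simp
    ultimately show "norm (f u / (A - u)\<^sup>2) \<le> 1 / (A - \<delta>)\<^sup>2"
      by (auto intro!: frac_le)
  qed (use pos in simp)
  then show ?thesis by simp
qed

lemma slope_error:
  "\<bar>smoothed_slope \<mu> a1 a2 p1 p2 \<delta> f - slope \<mu> a1 a2 p1 p2\<bar> \<le> slope_error_bound \<mu> a1 a2 p1 p2 \<delta>"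
proof -
  have "smoothed_slope \<mu> a1 a2 p1 p2 \<delta> f - slope \<mu> a1 a2 p1 p2 =
      exp (- \<mu> * (p1 + p2)) * exp \<mu> * (2 - exp (- \<mu>)) * B * exp \<mu> *
        (1 / (A + \<delta>) + 1 / (A - \<delta>) - 2 / A + transit_integral A \<delta>)"
    unfolding slope_eq[OF pos(1,2)] smoothed_slope_def
    by (simp add: A_def B_def transit_integral_def algebra_simps)
  moreover have "exp (- \<mu>) \<le> 1" using pos by simp
  then have "0 \<le> 2 - exp (- \<mu>)" by linarith
  ultimately have "\<bar>smoothed_slope \<mu> a1 a2 p1 p2 \<delta> f - slope \<mu> a1 a2 p1 p2\<bar> =
      exp (- \<mu> * (p1 + p2)) * exp \<mu> * (2 - exp (- \<mu>)) * B * exp \<mu> *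
        \<bar>1 / (A + \<delta>) + 1 / (A - \<delta>) - 2 / A + transit_integral A \<delta>\<bar>"
    using AB_pos by (simp add: abs_mult)
  also have "\<dots> \<le> exp (- \<mu> * (p1 + p2)) * exp \<mu> * (2 - exp (- \<mu>)) * B * exp \<mu> *
      (\<bar>1 / (A + \<delta>) + 1 / (A - \<delta>) - 2 / A\<bar> + 2 * \<delta> / (A - \<delta>)\<^sup>2)"
    using transit_integral_bound AB_pos \<open>0 \<le> 2 - exp (- \<mu>)\<close> by (intro mult_left_mono) auto
  finally show ?thesis by (simp add: slope_error_bound_def A_def B_def)
qed

subsection \<open>Sign changes and periodicity\<close>

definition "zero_fall = crossing \<mu> K A"
definition "zero_rise = crossing \<mu> C A"

lemma
  shows le_zero_fall: "t \<le> zero_fall \<longleftrightarrow> A * exp (\<mu> * t) \<le> K"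
    and zero_fall_le: "zero_fall \<le> t \<longleftrightarrow> K \<le> A * exp (\<mu> * t)"
    and le_zero_rise: "t \<le> zero_rise \<longleftrightarrow> A * exp (\<mu> * t) \<le> C"
    and zero_rise_le: "zero_rise \<le> t \<longleftrightarrow> C \<le> A * exp (\<mu> * t)"
  unfolding zero_fall_def zero_rise_def using AB_pos(1) by (simp_all add: falls rises)

lemma zero_order: "\<tau> \<le> zero_fall" "zero_fall \<le> \<tau>'" "\<sigma> \<le> zero_rise" "zero_rise \<le> \<sigma>'"
proof -
  have *: "w * exp (\<mu> * t) \<le> c" if "w' * exp (\<mu> * t) \<le> c" "w \<le> w'" for w w' t c
    using that by (meson exp_ge_zero mult_right_mono order_trans)
  show "\<tau> \<le> zero_fall" using *[of "A + \<delta>" \<tau> K A] le_\<tau>[of \<tau>] pos by (simp add: le_zero_fall)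
  show "zero_fall \<le> \<tau>'" using *[of A zero_fall K "A - \<delta>"] le_zero_fall[of zero_fall] pos by (simp add: le_\<tau>')
  show "\<sigma> \<le> zero_rise" using *[of "A + \<delta>" \<sigma> C A] le_\<sigma>[of \<sigma>] pos by (simp add: le_zero_rise)
  show "zero_rise \<le> \<sigma>'" using *[of A zero_rise C "A - \<delta>"] le_zero_rise[of zero_rise] pos by (simp add: le_\<sigma>')
qed

lemma fall_ge_0: "t \<in> {\<rho>..\<tau> + 1} \<Longrightarrow> 0 \<le> x t \<longleftrightarrow> t \<le> zero_fall"
  and fall_le_0: "t \<in> {\<rho>..\<tau> + 1} \<Longrightarrow> x t \<le> 0 \<longleftrightarrow> zero_fall \<le> t"
  and rise_ge_0: "t \<in> {\<tau>' + 1..p1} \<Longrightarrow> 0 \<le> x t \<longleftrightarrow> zero_rise \<le> t"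
  using Y_fall_explicit[of t] Y_rise_explicit[of t] x_ge_iff[of 0 t] x_le_iff[of t 0]
  by (simp_all add: le_zero_fall zero_fall_le zero_rise_le)

lemma x_zero_fall: "x zero_fall = 0"
  using zero_order time_order fall_ge_0[of zero_fall] fall_le_0[of zero_fall] by simp

lemma x_negative:
  assumes "zero_fall < t" "t < zero_rise"
  shows "x t < 0"
proof -
  consider "t \<le> \<tau> + 1" | "t \<in> {\<tau> + 1..\<tau>' + 1}" | "\<tau>' + 1 \<le> t" by fastforce
  then show ?thesis
  proof cases
    case 1
    then show ?thesis using assms zero_order time_order fall_ge_0[of t] by simp
  next
    case 2
    then show ?thesis using x_le_bottom pos(4) by fastforce
  next
    case 3
    then show ?thesis using assms zero_order time_order rise_ge_0[of t] by simp
  qed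
qed

lemma x_nonneg:
  assumes "0 \<le> t" "t \<le> p1 + p2" "t \<le> zero_fall \<or> zero_rise \<le> t"
  shows "0 \<le> x t"
proof -
  consider "t \<le> \<tau>" | "\<tau> \<le> t" "t \<le> zero_fall" | "zero_rise \<le> t" "t \<le> \<sigma>'" | "\<sigma>' \<le> t"
    using assms by linarith
  then show ?thesis
  proof cases
    case 1
    then show ?thesis using assms x_ge_start[of t] pos(4) by simp
  next
    case 2
    then show ?thesis using zero_order time_order fall_ge_0[of t] by simp
  next
    case 3
    then show ?thesis using zero_order time_order rise_ge_0[of t] by simp
  next
    case 4
    then show ?thesis using assms x_ge_end[of t] pos(4) by simp
  qed
qed

lemma period_gt_1: "1 < p1 + p2"
  using time_order by simp

text \<open>The orbit shifted by one period solves the same equation. Its initial segment differs in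
  general from the constant \<open>h\<close>, but lies above \<open>\<delta>\<close> and ends in
  \<open>h\<close>, so uniqueness for admissible initial functions applies.\<close>

lemma x_periodic:
  assumes "x (p1 + p2) = h" "t \<ge> 0"
  shows "x (t + (p1 + p2)) = x t"
proof -
  let ?y = "\<lambda>t. x (t + (p1 + p2))"
  have "solves_ivp \<mu> a f ?y ?y"
    unfolding solves_ivp_def
  proof (intro conjI ballI allI impI)
    show "continuous_on {-1..} ?y"
      using period_gt_1
      by (intro continuous_on_compose2[OF cont_x[OF order_refl]] continuous_intros) auto
    fix t :: real
    assume "t \<ge> 0"
    then have "(x has_real_derivative (- \<mu> * ?y t + a t * f (?y (t - 1)))) (at (t + (p1 + p2)))"
      using deriv_x[of "t + (p1 + p2)"] period_gt_1 a_period[of t] by (simp add: algebra_simps)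
    then show "(?y has_real_derivative (- \<mu> * ?y t + a t * f (?y (t - 1)))) (at t within {0..})"
      by (simp add: DERIV_shift has_field_derivative_at_within)
  qed simp
  moreover have "admissible_initial \<delta> h ?y"
    unfolding admissible_initial_def
  proof (intro conjI ballI)
    show "continuous_on {-1..0} ?y"
      using period_gt_1
      by (intro continuous_on_compose2[OF cont_x[OF order_refl]] continuous_intros) auto
    show "\<delta> \<le> ?y s" if "s \<in> {-1..0}" for s
      using that time_order by (intro x_ge_end) auto
  qed (use assms in simp)
  moreover have "admissible_initial \<delta> h (\<lambda>_. h)"
    using h_ge by (simp add: admissible_initial_def)
  ultimately show ?thesis
    using solves_ivp_unique[OF _ ivp f_pos] assms(2) by blast
qed

lemma x_periodic_multiple:
  assumes "x (p1 + p2) = h" "t \<ge> 0"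
  shows "x (t + real n * (p1 + p2)) = x t"
proof (induction n)
  case (Suc n)
  have "0 \<le> t + real n * (p1 + p2)" using assms(2) period_gt_1 by simp
  from x_periodic[OF assms(1) this] Suc show ?case by (simp add: algebra_simps)
qed simp

lemma a_periodic_multiple: "a (t + real n * (p1 + p2)) = a t"
proof (induction n)
  case (Suc n)
  then show ?case using a_period[of "t + real n * (p1 + p2)"] by (simp add: algebra_simps)
qed simp

text \<open>To the left of 0, \<open>x\<close> is the initial function and not the periodic orbit;
  reducing every time to the period starting at 0 avoids these values.\<close>

definition "periodic_extension t = x (t - (p1 + p2) * of_int \<lfloor>t / (p1 + p2)\<rfloor>)"

lemma periodic_extension_eq:
  assumes "x (p1 + p2) = h" "t + real n * (p1 + p2) \<ge> 0"
  shows "periodic_extension t = x (t + real n * (p1 + p2))"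
proof -
  let ?T = "p1 + p2" and ?k = "\<lfloor>t / (p1 + p2)\<rfloor>"
  have T: "?T > 0" using period_gt_1 by simp
  have "- real n \<le> t / ?T" using assms(2) T by (simp add: field_simps)
  then have "0 \<le> ?k + int n" by linarith
  then obtain m where m: "?k + int n = int m" using nonneg_int_cases by blast
  have "of_int ?k * ?T \<le> t" using T floor_divide_lower by blast
  then have "x (t - ?T * of_int ?k + real m * ?T) = x (t - ?T * of_int ?k)"
    by (intro x_periodic_multiple assms) (simp add: mult.commute)
  moreover have "real m = of_int ?k + real n"
    using m by (metis of_int_add of_int_of_nat_eq)
  ultimately show ?thesis by (simp add: periodic_extension_def algebra_simps)
qed

lemma periodic_extension_eq_x: "x (p1 + p2) = h \<Longrightarrow> t \<ge> 0 \<Longrightarrow> periodic_extension t = x t"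
  using periodic_extension_eq[of t 0] by simp

lemma corresponding_solution_periodic_extension:
  assumes "x (p1 + p2) = h"
  shows "corresponding_solution \<mu> a f (p1 + p2) h periodic_extension"
  unfolding corresponding_solution_def solves_on_line_def
proof (intro conjI allI exI[of _ x] ballI)
  fix t
  \<comment> \<open>The 2 leaves room for the delayed time \<open>t - 1\<close> and for a
    neighbourhood of \<open>t\<close>, all shifted to nonnegative times.\<close>
  obtain n where n: "2 - t \<le> real n" using real_arch_simple by blast
  let ?N = "real n * (p1 + p2)"
  have "real n \<le> ?N" using period_gt_1 by (simp add: mult_le_cancel_left1)
  with n have N: "2 \<le> t + ?N" by linarith
  have eq: "periodic_extension s = x (s + ?N)" if "s \<in> {t - 2<..}" for s
    using that N by (intro periodic_extension_eq assms) auto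
  have "(x has_real_derivative (- \<mu> * periodic_extension t + a t * f (periodic_extension (t - 1)))) (at (t + ?N))"
    using deriv_x[of "t + ?N"] N a_periodic_multiple[of t n] eq[of t] eq[of "t - 1"]
    by (simp add: algebra_simps)
  then have "((\<lambda>s. x (s + ?N)) has_real_derivative (- \<mu> * periodic_extension t + a t * f (periodic_extension (t - 1)))) (at t)"
    by (simp add: DERIV_shift)
  then show "(periodic_extension has_real_derivative (- \<mu> * periodic_extension t + a t * f (periodic_extension (t - 1)))) (at t)"
    by (rule has_field_derivative_transform_within_open[where S = "{t - 2<..}"]) (use eq in auto)
next
  show "periodic_extension 0 = h" using periodic_extension_eq_x[OF assms, of 0] by (simp add: x_init)
  show "periodic_extension s = x (p1 + p2 + s)" if "s \<in> {-1..0}" for s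
    using that period_gt_1 periodic_extension_eq[OF assms, of s 1] by (simp add: algebra_simps)
qed (rule ivp)

text \<open>A smaller period \<open>q\<close> would carry the zero \<open>zero_fall\<close> to a
  zero, hence out of the negative interval. Points just after \<open>zero_fall\<close>, where the
  orbit is negative, would then be carried to points where it is nonnegative.\<close>

lemma minimal_period_periodic_extension:
  assumes "x (p1 + p2) = h"
  shows "minimal_period (p1 + p2) periodic_extension"
  unfolding minimal_period_def
proof (intro conjI allI impI)
  let ?T = "p1 + p2"
  have T: "?T > 0" using period_gt_1 by simp
  show "0 < ?T" by (fact T)
  fix t
  have "(t + ?T) / ?T = t / ?T + 1" using T by (simp add: add_divide_distrib)
  then show "periodic_extension (t + ?T) = periodic_extension t" by (simp add: periodic_extension_def algebra_simps)
next
  fix q assume q: "0 < q \<and> q < p1 + p2"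
  have z: "0 < zero_fall" "zero_fall < zero_rise" "zero_rise < p1 + p2"
    using zero_order time_order by auto
  show "\<not> (\<forall>t. periodic_extension (t + q) = periodic_extension t)"
  proof
    assume *: "\<forall>t. periodic_extension (t + q) = periodic_extension t"
    have per: "x (t + q) = x t" if "t \<ge> 0" for t
      using *[rule_format, of t] periodic_extension_eq_x[OF assms, of t] periodic_extension_eq_x[OF assms, of "t + q"] that q by simp
    have "\<not> x (zero_fall + q) < 0"
      using per[of zero_fall] z by (simp add: x_zero_fall)
    then have zq: "zero_rise \<le> zero_fall + q"
      using x_negative[of "zero_fall + q"] q by linarith
    \<comment> \<open>Below the first argument of \<open>min\<close>, \<open>zero_fall + s\<close>
      stays in the negative interval; below the second, its shift by \<open>q\<close> stays before
      the next negative interval.\<close>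
    define s where "s = min (zero_rise - zero_fall) (p1 + p2 - q) / 2"
    have s: "0 < s" "s < zero_rise - zero_fall" "s < p1 + p2 - q"
      using z q by (auto simp: s_def min_def)
    define t where "t = zero_fall + s + q"
    have t: "zero_rise \<le> t" "t < zero_fall + (p1 + p2)" using s zq by (auto simp: t_def)
    have "0 \<le> x t"
    proof (cases "t \<le> p1 + p2")
      case True
      then show ?thesis using t z by (intro x_nonneg) auto
    next
      case False
      then have "0 \<le> x (t - (p1 + p2))" using t z by (intro x_nonneg) auto
      then show ?thesis using x_periodic[OF assms, of "t - (p1 + p2)"] False by simp
    qed
    moreover have "x (zero_fall + s) < 0" using s by (intro x_negative) auto
    ultimately show False using per[of "zero_fall + s"] z s by (simp add: t_def)
  qed
qed

end

subsection \<open>Perturbation of the fixed point\<close>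

text \<open>Subtracting the fixed point equations gives
  \<open>(h - z) * (1 - m') = (m' - m) * (z + A)\<close>. The second hypothesis keeps
  \<open>1 - m'\<close> at least half as far from 0 as \<open>1 - m\<close>.\<close>

lemma affine_fixed_point_perturbation:
  fixes m m' A c z :: real
  assumes "z = m * (z + A) + c" "\<bar>m' - m\<bar> < \<bar>1 - m\<bar> / 2"
  shows "h = m' * (h + A) + c \<longleftrightarrow> h = z + (m' - m) * (z + A) / (1 - m')"
    and "\<bar>(m' - m) * (z + A) / (1 - m')\<bar> \<le> 2 * \<bar>m' - m\<bar> * \<bar>z + A\<bar> / \<bar>1 - m\<bar>"
proof -
  have half: "\<bar>1 - m\<bar> / 2 < \<bar>1 - m'\<bar>" and "\<bar>1 - m\<bar> > 0"
    using assms(2) by (simp_all add: abs_if split: if_splits)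
  then have nz: "1 - m' \<noteq> 0" by auto
  have "h = m' * (h + A) + c \<longleftrightarrow> (h - z) * (1 - m') = (m' - m) * (z + A)"
    using assms(1) by algebra
  also have "\<dots> \<longleftrightarrow> h - z = (m' - m) * (z + A) / (1 - m')"
    using nz by (simp add: eq_divide_eq)
  finally show "h = m' * (h + A) + c \<longleftrightarrow> h = z + (m' - m) * (z + A) / (1 - m')"
    by linarith
  have "\<bar>(m' - m) * (z + A) / (1 - m')\<bar> = \<bar>m' - m\<bar> * \<bar>z + A\<bar> / \<bar>1 - m'\<bar>"
    by (simp add: abs_mult)
  also have "\<dots> \<le> \<bar>m' - m\<bar> * \<bar>z + A\<bar> / (\<bar>1 - m\<bar> / 2)"
    using half nz \<open>\<bar>1 - m\<bar> > 0\<close> by (intro divide_left_mono mult_pos_pos) auto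
  finally show "\<bar>(m' - m) * (z + A) / (1 - m')\<bar> \<le> 2 * \<bar>m' - m\<bar> * \<bar>z + A\<bar> / \<bar>1 - m\<bar>"
    by (simp add: mult_ac)
qed

section \<open>Persistence of the nondegeneracy conditions\<close>

lemma tendsto_eventually_less:
  fixes f g :: "'a \<Rightarrow> real"
  assumes "(f \<longlongrightarrow> l) F" "(g \<longlongrightarrow> m) F" "l < m"
  shows "\<forall>\<^sub>F z in F. f z < g z"
proof -
  have "((\<lambda>z. g z - f z) \<longlongrightarrow> m - l) F" by (intro tendsto_intros assms)
  from order_tendstoD(1)[OF this, of 0] show ?thesis using assms(3) by simp
qed

lemma tendsto_crossing:
  assumes "(k \<longlongrightarrow> K) F" "(w \<longlongrightarrow> W) F" "K > 0" "W > 0" "\<mu> \<noteq> 0"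
  shows "((\<lambda>z. crossing \<mu> (k z) (w z)) \<longlongrightarrow> crossing \<mu> K W) F"
  unfolding crossing_def using assms by (intro tendsto_intros) auto

text \<open>All inequalities are strict at \<open>\<delta> = \<rho> = 0\<close> and
  \<open>h = hs\<close>, where both fall times equal \<open>switch1\<close> and both rise times
  \<open>switch2\<close>, and their sides are continuous there.\<close>

lemma eventually_nondegenerate:
  assumes "\<mu> > 0" "a1 > 0" "a2 > 0" "hs > 0"
    and "return_map \<mu> a1 a2 p1 p2 hs = hs"
    and "0 < switch1 \<mu> a1 hs"
    and "switch1 \<mu> a1 hs + 1 < switch2 \<mu> a1 hs"
    and "switch2 \<mu> a1 hs < p1"
    and "p1 < switch2 \<mu> a1 hs + 1"
    and "switch2 \<mu> a1 hs + 1 < p1 + p2"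
  shows "\<forall>\<^sub>F (h, \<delta>, \<rho>) in nhds hs \<times>\<^sub>F nhds 0 \<times>\<^sub>F nhds 0. nondegenerate \<mu> a1 a2 p1 p2 h \<delta> \<rho>"
proof -
  define A where "A = a1 / \<mu>"
  define B where "B = a2 / \<mu>"
  define C where "C = rise_amplitude \<mu> a1 hs"
  have A: "A > 0" and K: "hs + A > 0" using assms by (auto simp: A_def add_pos_pos)
  have L: "2 - exp (- \<mu>) > 1" using assms(1) by simp
  have C_eq: "C = (hs + A) * exp \<mu> * (2 - exp (- \<mu>))"
    by (simp add: C_def rise_amplitude_def A_def)
  have C: "C > 0" unfolding C_eq using K L by (intro mult_pos_pos exp_gt_zero) linarith+
  have s1: "crossing \<mu> (hs + A) A = switch1 \<mu> a1 hs"
  proof -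
    have "(hs + A) / A = (\<mu> * hs + a1) / a1" using assms by (simp add: A_def field_simps)
    then show ?thesis by (simp add: crossing_def switch1_def)
  qed
  have s2: "crossing \<mu> C A = switch2 \<mu> a1 hs"
  proof -
    have "C / A = (hs + A) / A * exp \<mu> * (2 - exp (- \<mu>))" by (simp add: C_eq)
    moreover have "0 < (hs + A) / A" "0 < 2 - exp (- \<mu>)" using A K L by (simp, linarith)
    ultimately have "ln (C / A) = ln ((hs + A) / A) + \<mu> + ln (2 - exp (- \<mu>))"
      by (simp only: ln_mult_pos mult_pos_pos exp_gt_zero ln_exp)
    then show ?thesis
      using assms(1) unfolding switch2_def s1[symmetric] by (simp add: crossing_def add_divide_distrib)
  qed
  have bottom: "A + 0 < (A - 0) * (2 * A / (A + 0) - exp (- \<mu>))"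
    using A L by simp
  have peak: "0 < exp (- \<mu>) * (A - C * exp (- \<mu> * p1))"
  proof -
    have "\<not> p1 \<le> crossing \<mu> C A" using assms(8) by (simp add: s2)
    then have "C < A * exp (\<mu> * p1)" using le_crossing_iff[OF assms(1) C A] by simp
    then have "C * exp (- \<mu> * p1) < A * exp (\<mu> * p1) * exp (- \<mu> * p1)" by simp
    also have "\<dots> = A" by (simp add: mult.assoc flip: exp_add)
    finally show ?thesis by simp
  qed
  have final: "0 * exp (\<mu> * (p1 + p2)) <
    C * (2 * B * exp \<mu> / (A + 0) - 1) + (A - B) * exp (\<mu> * p1) - B * exp (\<mu> * (p1 + p2))"
    (is "_ < ?R")
  proof -
    \<comment> \<open>The fixed point equation times \<open>exp (\<mu> * (p1 + p2))\<close>
      identifies the right-hand side with a positive multiple of \<open>hs\<close>.\<close>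
    have "hs = exp (- \<mu> * (p1 + p2)) * exp \<mu> * (2 - exp (- \<mu>)) * (B * exp \<mu> * (2 / A) - 1) * (hs + A)
        + (A - B) * exp (- \<mu> * p2) - B"
      using assms(5) unfolding return_map_affine[OF assms(2)] slope_eq[OF assms(1,2)]
      by (simp add: A_def B_def diff_divide_distrib)
    moreover have "exp (\<mu> * (p1 + p2)) * exp (- \<mu> * p2) = exp (\<mu> * p1)"
      and "exp (\<mu> * (p1 + p2)) * exp (- \<mu> * (p1 + p2)) = 1"
      by (simp_all add: algebra_simps flip: exp_add)
    moreover have "2 * B * exp \<mu> / (A + 0) = B * exp \<mu> * (2 / A)" by simp
    ultimately have "exp (\<mu> * (p1 + p2)) * hs = ?R"
      unfolding C_eq by algebra
    moreover have "0 < exp (\<mu> * (p1 + p2)) * hs" using assms(4) by simp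
    ultimately show ?thesis by simp
  qed
  let ?F = "nhds hs \<times>\<^sub>F nhds (0::real) \<times>\<^sub>F nhds (0::real)"
  define h :: "real \<times> real \<times> real \<Rightarrow> real" where "h = fst"
  define \<delta> :: "real \<times> real \<times> real \<Rightarrow> real" where "\<delta> = (\<lambda>z. fst (snd z))"
  define \<rho> :: "real \<times> real \<times> real \<Rightarrow> real" where "\<rho> = (\<lambda>z. snd (snd z))"
  have h: "(h \<longlongrightarrow> hs) ?F"
    unfolding h_def by (rule filterlim_fst)
  have \<delta>: "(\<delta> \<longlongrightarrow> 0) ?F"
    unfolding \<delta>_def by (rule filterlim_compose[OF filterlim_fst filterlim_snd])
  have \<rho>: "(\<rho> \<longlongrightarrow> 0) ?F"
    unfolding \<rho>_def by (rule filterlim_compose[OF filterlim_snd filterlim_snd])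
  define k where "k z = h z + A" for z
  define c where "c z = rise_amplitude \<mu> a1 (h z)" for z
  have k: "(k \<longlongrightarrow> hs + A) ?F" unfolding k_def by (intro tendsto_intros h)
  have c: "(c \<longlongrightarrow> C) ?F"
    unfolding c_def C_def rise_amplitude_def by (intro tendsto_intros h)
  have w: "((\<lambda>z. A + \<delta> z) \<longlongrightarrow> A) ?F" "((\<lambda>z. A - \<delta> z) \<longlongrightarrow> A) ?F"
    using tendsto_add[OF tendsto_const[of A] \<delta>] tendsto_diff[OF tendsto_const[of A] \<delta>] by simp_all
  have \<mu>: "\<mu> \<noteq> 0" using assms(1) by simp
  note t = tendsto_crossing[OF k w(1) K A \<mu>, unfolded s1] tendsto_crossing[OF k w(2) K A \<mu>, unfolded s1]
    tendsto_crossing[OF c w(1) C A \<mu>, unfolded s2] tendsto_crossing[OF c w(2) C A \<mu>, unfolded s2]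
  note less = tendsto_eventually_less
  have "\<forall>\<^sub>F z in ?F. 0 < k z" by (rule less[OF tendsto_const k K])
  moreover have "\<forall>\<^sub>F z in ?F. \<delta> z < A" by (rule less[OF \<delta> tendsto_const A])
  moreover have "\<forall>\<^sub>F z in ?F. \<rho> z < crossing \<mu> (k z) (A + \<delta> z)"
    by (rule less[OF \<rho> t(1)]) (use assms in simp)
  moreover have "\<forall>\<^sub>F z in ?F. crossing \<mu> (k z) (A - \<delta> z) < crossing \<mu> (k z) (A + \<delta> z) + 1"
    by (rule less[OF t(2) tendsto_add[OF t(1) tendsto_const]]) simp
  moreover have "\<forall>\<^sub>F z in ?F. A + \<delta> z < (A - \<delta> z) * (2 * A / (A + \<delta> z) - exp (- \<mu>))"
    by (rule less[OF _ _ bottom]) (intro tendsto_intros \<delta>; use A in simp)+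
  moreover have "\<forall>\<^sub>F z in ?F. crossing \<mu> (k z) (A - \<delta> z) + 1 < crossing \<mu> (c z) (A + \<delta> z)"
    by (rule less[OF tendsto_add[OF t(2) tendsto_const] t(3)]) (use assms in simp)
  moreover have "\<forall>\<^sub>F z in ?F. crossing \<mu> (c z) (A - \<delta> z) < p1"
    by (rule less[OF t(4) tendsto_const]) (use assms in simp)
  moreover have "\<forall>\<^sub>F z in ?F. p1 + \<rho> z < crossing \<mu> (c z) (A + \<delta> z) + 1"
    by (rule less[OF tendsto_add[OF tendsto_const \<rho>] tendsto_add[OF t(3) tendsto_const]])
      (use assms in simp)
  moreover have "\<forall>\<^sub>F z in ?F. crossing \<mu> (c z) (A - \<delta> z) + 1 < p1 + p2"
    by (rule less[OF tendsto_add[OF t(4) tendsto_const] tendsto_const]) (use assms in simp)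
  moreover have "\<forall>\<^sub>F z in ?F. \<delta> z < exp (- \<mu>) * (A - c z * exp (- \<mu> * p1))"
    by (rule less[OF \<delta> _ peak]) (intro tendsto_intros c)
  moreover have "\<forall>\<^sub>F z in ?F. \<delta> z * exp (\<mu> * (p1 + p2)) <
      c z * (2 * B * exp \<mu> / (A + \<delta> z) - 1) + (A - B) * exp (\<mu> * p1) - B * exp (\<mu> * (p1 + p2))"
    by (rule less[OF _ _ final]) (intro tendsto_intros \<delta> c; use A in simp)+
  ultimately have "\<forall>\<^sub>F z in ?F. nondegenerate \<mu> a1 a2 p1 p2 (h z) (\<delta> z) (\<rho> z)"
    by eventually_elim (simp add: nondegenerate_def Let_def A_def B_def k_def c_def)
  then show ?thesis by (simp add: h_def \<delta>_def \<rho>_def case_prod_unfold)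
qed

lemma eventually_small_interval:
  assumes "\<forall>\<^sub>F d in nhds (0::real). P d"
  obtains d0 where "d0 > 0" "\<And>d. 0 < d \<Longrightarrow> d < d0 \<Longrightarrow> P d"
proof -
  obtain d0 where "d0 > 0" "\<And>d. dist d 0 < d0 \<Longrightarrow> P d"
    using assms unfolding eventually_nhds_metric by blast
  then show thesis by (intro that[of d0]) (auto simp: dist_real_def)
qed

theorem theorem3p5:
  fixes \<mu> a1 a2 p1 p2 hs :: real
  assumes "\<mu> > 0" "a1 > 0" "a2 > 0" "p1 > 0" "p2 > 0"
    and "slope \<mu> a1 a2 p1 p2 \<noteq> 1"
    and "hs > 0" and "return_map \<mu> a1 a2 p1 p2 hs = hs"
    and "0 < switch1 \<mu> a1 hs"
    and "switch1 \<mu> a1 hs + 1 < switch2 \<mu> a1 hs"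
    and "switch2 \<mu> a1 hs < p1"
    and "p1 < switch2 \<mu> a1 hs + 1"
    and "switch2 \<mu> a1 hs + 1 < p1 + p2"
  shows "deriv (return_map \<mu> a1 a2 p1 p2) hs = slope \<mu> a1 a2 p1 p2 \<and>
    (\<exists>r>0. \<exists>\<delta>0>0. \<exists>\<rho>0>0.
      (\<forall>\<delta> \<rho> f a. 0 < \<delta> \<and> \<delta> < \<delta>0 \<and> 0 < \<rho> \<and> \<rho> < \<rho>0 \<and>
          smoothed_feedback \<mu> a1 \<delta> f \<and> smoothed_coefficient \<mu> a1 a2 p1 p2 \<rho> a \<longrightarrow>
        (\<exists>!h. h \<in> ball hs r \<and> smoothed_return_map \<mu> a f \<delta> (p1 + p2) h = h) \<and>
        (\<forall>h \<in> ball hs r. smoothed_return_map \<mu> a f \<delta> (p1 + p2) h = h \<longrightarrow>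
          smoothed_return_map \<mu> a f \<delta> (p1 + p2) differentiable (at h) \<and>
          (\<exists>p. corresponding_solution \<mu> a f (p1 + p2) h p \<and> minimal_period (p1 + p2) p))) \<and>
      (\<forall>\<epsilon>>0. \<exists>\<delta>1>0. \<forall>\<delta> \<rho> f a. 0 < \<delta> \<and> \<delta> < \<delta>0 \<and> \<delta> < \<delta>1 \<and> 0 < \<rho> \<and> \<rho> < \<rho>0 \<and>
          smoothed_feedback \<mu> a1 \<delta> f \<and> smoothed_coefficient \<mu> a1 a2 p1 p2 \<rho> a \<longrightarrow>
        (\<forall>h \<in> ball hs r. smoothed_return_map \<mu> a f \<delta> (p1 + p2) h = h \<longrightarrow>
          \<bar>h - hs\<bar> < \<epsilon> \<and>
          \<bar>deriv (smoothed_return_map \<mu> a f \<delta> (p1 + p2)) h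
             - deriv (return_map \<mu> a1 a2 p1 p2) hs\<bar> < \<epsilon>)))"
proof -
  define m where "m = slope \<mu> a1 a2 p1 p2"
  define A where "A = a1 / \<mu>"
  define c where "c = (a1 - a2) / \<mu> * exp (- \<mu> * p2) - a2 / \<mu>"
  define E where "E = slope_error_bound \<mu> a1 a2 p1 p2"
  have m: "m \<noteq> 1" using assms by (simp add: m_def)
  have hsA: "hs + A > 0" using assms by (simp add: A_def add_pos_pos)
  have fixed: "hs = m * (hs + A) + c"
    using assms(8) unfolding return_map_affine[OF assms(2)] m_def A_def c_def by linarith
  have deriv_F: "deriv (return_map \<mu> a1 a2 p1 p2) hs = m"
    unfolding return_map_def m_def by (intro DERIV_imp_deriv) (auto intro!: derivative_eq_intros)

  \<comment> \<open>The product filter provides a box, so that \<open>r\<close> does not depend on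
    \<open>\<delta>\<close> and \<open>\<rho>\<close>.\<close>
  obtain r \<delta>' \<rho>0 where box: "r > 0" "\<delta>' > 0" "\<rho>0 > 0"
    and nondeg: "\<And>h \<delta> \<rho>. h \<in> ball hs r \<Longrightarrow> 0 < \<delta> \<Longrightarrow> \<delta> < \<delta>' \<Longrightarrow> 0 < \<rho> \<Longrightarrow> \<rho> < \<rho>0 \<Longrightarrow>
      nondegenerate \<mu> a1 a2 p1 p2 h \<delta> \<rho>"
  proof -
    obtain P Q where P: "\<forall>\<^sub>F h in nhds hs. P h" and Q: "\<forall>\<^sub>F z in nhds (0::real) \<times>\<^sub>F nhds (0::real). Q z"
      and PQ: "\<And>h z. P h \<Longrightarrow> Q z \<Longrightarrow> (case (h, z) of (h, \<delta>, \<rho>) \<Rightarrow> nondegenerate \<mu> a1 a2 p1 p2 h \<delta> \<rho>)"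
      using eventually_nondegenerate[OF assms(1-3,7-13)] unfolding eventually_prod_filter by metis
    obtain R S where R: "\<forall>\<^sub>F \<delta> in nhds 0. R \<delta>" and S: "\<forall>\<^sub>F \<rho> in nhds 0. S \<rho>"
      and RS: "\<And>\<delta> \<rho>. R \<delta> \<Longrightarrow> S \<rho> \<Longrightarrow> Q (\<delta>, \<rho>)"
      using Q unfolding eventually_prod_filter by metis
    obtain r where r: "r > 0" "\<And>h. dist h hs < r \<Longrightarrow> P h"
      using P unfolding eventually_nhds_metric by blast
    obtain \<delta>' where \<delta>': "\<delta>' > 0" "\<And>\<delta>. 0 < \<delta> \<Longrightarrow> \<delta> < \<delta>' \<Longrightarrow> R \<delta>"
      using eventually_small_interval[OF R] by blast
    obtain \<rho>0 where \<rho>0: "\<rho>0 > 0" "\<And>\<rho>. 0 < \<rho> \<Longrightarrow> \<rho> < \<rho>0 \<Longrightarrow> S \<rho>"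
      using eventually_small_interval[OF S] by blast
    show thesis
    proof (rule that[OF r(1) \<delta>'(1) \<rho>0(1)])
      fix h \<delta> \<rho> assume "h \<in> ball hs r" "0 < \<delta>" "\<delta> < \<delta>'" "0 < \<rho>" "\<rho> < \<rho>0"
      then show "nondegenerate \<mu> a1 a2 p1 p2 h \<delta> \<rho>"
        using PQ[of h "(\<delta>, \<rho>)"] RS \<delta>' \<rho>0 r by (simp add: dist_commute)
    qed
  qed

  have E_small: "\<exists>d>0. \<forall>\<delta>. 0 < \<delta> \<and> \<delta> < d \<longrightarrow>
      E \<delta> < \<bar>1 - m\<bar> / 2 \<and> E \<delta> < \<epsilon> \<and> 2 * E \<delta> * \<bar>hs + A\<bar> / \<bar>1 - m\<bar> < \<epsilon>" if "\<epsilon> > 0" for \<epsilon>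
  proof -
    have lim: "(E \<longlongrightarrow> 0) (nhds 0)"
      unfolding E_def by (rule slope_error_bound_tendsto[OF assms(1,2)])
    have "((\<lambda>\<delta>. 2 * E \<delta> * \<bar>hs + A\<bar> / \<bar>1 - m\<bar>) \<longlongrightarrow> 2 * 0 * \<bar>hs + A\<bar> / \<bar>1 - m\<bar>) (nhds 0)"
      using m by (intro tendsto_intros lim) auto
    then have "\<forall>\<^sub>F \<delta> in nhds 0. E \<delta> < \<bar>1 - m\<bar> / 2 \<and> E \<delta> < \<epsilon> \<and> 2 * E \<delta> * \<bar>hs + A\<bar> / \<bar>1 - m\<bar> < \<epsilon>"
      using m that by (intro eventually_conj order_tendstoD(2)[OF lim] order_tendstoD(2)) auto
    then show ?thesis by (rule eventually_small_interval) blast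
  qed

  \<comment> \<open>The first bound keeps the smoothed slope away from 1, the second places the
    perturbed fixed point inside the ball.\<close>
  obtain \<delta>'' where \<delta>'': "\<delta>'' > 0" "\<And>\<delta>. 0 < \<delta> \<Longrightarrow> \<delta> < \<delta>'' \<Longrightarrow>
      E \<delta> < \<bar>1 - m\<bar> / 2 \<and> 2 * E \<delta> * \<bar>hs + A\<bar> / \<bar>1 - m\<bar> < r"
    using E_small[OF box(1)] by blast
  define \<delta>0 where "\<delta>0 = min \<delta>' \<delta>''"

  have orbit: "\<exists>x. smoothed_orbit \<mu> a1 a2 p1 p2 \<delta> \<rho> h f a x"
    if "0 < \<delta>" "\<delta> < \<delta>0" "0 < \<rho>" "\<rho> < \<rho>0" "smoothed_feedback \<mu> a1 \<delta> f"
      "smoothed_coefficient \<mu> a1 a2 p1 p2 \<rho> a" "h \<in> ball hs r" for \<delta> \<rho> f a h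
  proof -
    have "\<exists>x. solves_ivp \<mu> a f (\<lambda>_. h) x"
      using that(5,6)
      by (intro solves_ivp_exists)
        (auto simp: smoothed_feedback_def smoothed_coefficient_def intro: C_infinity_continuous_on)
    then obtain x where "solves_ivp \<mu> a f (\<lambda>_. h) x" by blast
    then have "smoothed_orbit \<mu> a1 a2 p1 p2 \<delta> \<rho> h f a x"
      using that assms nondeg[of h \<delta> \<rho>] by unfold_locales (auto simp: \<delta>0_def)
    then show ?thesis by blast
  qed

  have main: "\<exists>m'. \<bar>m' - m\<bar> \<le> E \<delta> \<and>
      (\<forall>h \<in> ball hs r. smoothed_return_map \<mu> a f \<delta> (p1 + p2) h = m' * (h + A) + c \<and>
        (smoothed_return_map \<mu> a f \<delta> (p1 + p2) has_real_derivative m') (at h))"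
    if hyps: "0 < \<delta>" "\<delta> < \<delta>0" "0 < \<rho>" "\<rho> < \<rho>0" "smoothed_feedback \<mu> a1 \<delta> f"
      "smoothed_coefficient \<mu> a1 a2 p1 p2 \<rho> a" for \<delta> \<rho> f a
  proof (intro exI conjI ballI)
    let ?m = "smoothed_slope \<mu> a1 a2 p1 p2 \<delta> f"
    \<comment> \<open>The slope does not depend on \<open>h\<close>, so the orbit through the centre
      \<open>hs\<close> suffices for its estimate.\<close>
    obtain x where "smoothed_orbit \<mu> a1 a2 p1 p2 \<delta> \<rho> hs f a x"
      using orbit[OF hyps, of hs] box(1) by auto
    then show "\<bar>?m - m\<bar> \<le> E \<delta>"
      unfolding m_def E_def by (rule smoothed_orbit.slope_error)
    have affine: "smoothed_return_map \<mu> a f \<delta> (p1 + p2) h = ?m * (h + A) + c" if h: "h \<in> ball hs r" for h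
    proof -
      obtain x where x: "smoothed_orbit \<mu> a1 a2 p1 p2 \<delta> \<rho> h f a x"
        using orbit[OF hyps h] by blast
      show ?thesis
        using smoothed_orbit.return_map_eq[OF x] smoothed_orbit.x_return[OF x]
        by (simp add: A_def c_def)
    qed
    fix h assume h: "h \<in> ball hs r"
    show "smoothed_return_map \<mu> a f \<delta> (p1 + p2) h = ?m * (h + A) + c" by (rule affine[OF h])
    have "((\<lambda>h. ?m * (h + A) + c) has_real_derivative ?m) (at h)"
      by (auto intro!: derivative_eq_intros)
    then show "(smoothed_return_map \<mu> a f \<delta> (p1 + p2) has_real_derivative ?m) (at h)"
      by (rule has_field_derivative_transform_within_open[where S = "ball hs r"])
        (use h affine in auto)
  qed

  have existence: "(\<exists>!h. h \<in> ball hs r \<and> smoothed_return_map \<mu> a f \<delta> (p1 + p2) h = h) \<and>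
      (\<forall>h \<in> ball hs r. smoothed_return_map \<mu> a f \<delta> (p1 + p2) h = h \<longrightarrow>
        smoothed_return_map \<mu> a f \<delta> (p1 + p2) differentiable (at h) \<and>
        (\<exists>p. corresponding_solution \<mu> a f (p1 + p2) h p \<and> minimal_period (p1 + p2) p))"
    if hyps: "0 < \<delta>" "\<delta> < \<delta>0" "0 < \<rho>" "\<rho> < \<rho>0" "smoothed_feedback \<mu> a1 \<delta> f"
      "smoothed_coefficient \<mu> a1 a2 p1 p2 \<rho> a" for \<delta> \<rho> f a
  proof
    let ?F = "smoothed_return_map \<mu> a f \<delta> (p1 + p2)"
    obtain m' where m': "\<bar>m' - m\<bar> \<le> E \<delta>"
      and F: "\<And>h. h \<in> ball hs r \<Longrightarrow> ?F h = m' * (h + A) + c"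
        "\<And>h. h \<in> ball hs r \<Longrightarrow> (?F has_real_derivative m') (at h)"
      using main[OF hyps] by blast
    have E: "E \<delta> < \<bar>1 - m\<bar> / 2" "2 * E \<delta> * \<bar>hs + A\<bar> / \<bar>1 - m\<bar> < r"
      using \<delta>''(2)[of \<delta>] hyps(1,2) by (auto simp: \<delta>0_def)
    let ?h = "hs + (m' - m) * (hs + A) / (1 - m')"
    note pert = affine_fixed_point_perturbation[OF fixed, of m']
    have close: "\<bar>m' - m\<bar> < \<bar>1 - m\<bar> / 2" using m' E by simp
    have "2 * \<bar>m' - m\<bar> * \<bar>hs + A\<bar> / \<bar>1 - m\<bar> \<le> 2 * E \<delta> * \<bar>hs + A\<bar> / \<bar>1 - m\<bar>"
      using m' by (intro divide_right_mono mult_right_mono) auto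
    then have "?h \<in> ball hs r" using pert(2)[OF close] E(2) by (simp add: dist_real_def)
    moreover have "h = m' * (h + A) + c \<longleftrightarrow> h = ?h" for h by (rule pert(1)[OF close])
    ultimately show "\<exists>!h. h \<in> ball hs r \<and> ?F h = h" using F(1) by metis
    show "\<forall>h \<in> ball hs r. ?F h = h \<longrightarrow> ?F differentiable (at h) \<and>
        (\<exists>p. corresponding_solution \<mu> a f (p1 + p2) h p \<and> minimal_period (p1 + p2) p)"
    proof (intro ballI impI conjI)
      fix h assume h: "h \<in> ball hs r" "?F h = h"
      show "?F differentiable (at h)" using F(2)[OF h(1)] real_differentiable_def by blast
      obtain x where "smoothed_orbit \<mu> a1 a2 p1 p2 \<delta> \<rho> h f a x"
        using orbit[OF hyps h(1)] by blast
      then interpret smoothed_orbit \<mu> a1 a2 p1 p2 \<delta> \<rho> h f a x .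
      have "x (p1 + p2) = h" using return_map_eq h(2) by simp
      then show "\<exists>p. corresponding_solution \<mu> a f (p1 + p2) h p \<and> minimal_period (p1 + p2) p"
        using corresponding_solution_periodic_extension minimal_period_periodic_extension by blast
    qed
  qed

  have convergence: "\<exists>\<delta>1>0. \<forall>\<delta> \<rho> f a. 0 < \<delta> \<and> \<delta> < \<delta>0 \<and> \<delta> < \<delta>1 \<and> 0 < \<rho> \<and> \<rho> < \<rho>0 \<and>
        smoothed_feedback \<mu> a1 \<delta> f \<and> smoothed_coefficient \<mu> a1 a2 p1 p2 \<rho> a \<longrightarrow>
      (\<forall>h \<in> ball hs r. smoothed_return_map \<mu> a f \<delta> (p1 + p2) h = h \<longrightarrow>
        \<bar>h - hs\<bar> < \<epsilon> \<and> \<bar>deriv (smoothed_return_map \<mu> a f \<delta> (p1 + p2)) h - m\<bar> < \<epsilon>)"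
    if "\<epsilon> > 0" for \<epsilon>
  proof -
    obtain \<delta>1 where \<delta>1: "\<delta>1 > 0" "\<And>\<delta>. 0 < \<delta> \<Longrightarrow> \<delta> < \<delta>1 \<Longrightarrow>
        E \<delta> < \<bar>1 - m\<bar> / 2 \<and> E \<delta> < \<epsilon> \<and> 2 * E \<delta> * \<bar>hs + A\<bar> / \<bar>1 - m\<bar> < \<epsilon>"
      using E_small[OF \<open>\<epsilon> > 0\<close>] by blast
    have "\<bar>h - hs\<bar> < \<epsilon> \<and> \<bar>deriv (smoothed_return_map \<mu> a f \<delta> (p1 + p2)) h - m\<bar> < \<epsilon>"
      if hyps: "0 < \<delta>" "\<delta> < \<delta>0" "0 < \<rho>" "\<rho> < \<rho>0" "smoothed_feedback \<mu> a1 \<delta> f"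
        "smoothed_coefficient \<mu> a1 a2 p1 p2 \<rho> a"
        and "\<delta> < \<delta>1" and h: "h \<in> ball hs r" "smoothed_return_map \<mu> a f \<delta> (p1 + p2) h = h"
      for \<delta> \<rho> f a h
    proof -
      obtain m' where m': "\<bar>m' - m\<bar> \<le> E \<delta>"
        and F: "smoothed_return_map \<mu> a f \<delta> (p1 + p2) h = m' * (h + A) + c"
          "(smoothed_return_map \<mu> a f \<delta> (p1 + p2) has_real_derivative m') (at h)"
        using main[OF hyps] h(1) by blast
      have E: "E \<delta> < \<bar>1 - m\<bar> / 2" "E \<delta> < \<epsilon>" "2 * E \<delta> * \<bar>hs + A\<bar> / \<bar>1 - m\<bar> < \<epsilon>"
        using \<delta>1(2)[OF hyps(1) \<open>\<delta> < \<delta>1\<close>] by auto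
      note pert = affine_fixed_point_perturbation[OF fixed, of m']
      have close: "\<bar>m' - m\<bar> < \<bar>1 - m\<bar> / 2" using m' E by simp
      have "h = hs + (m' - m) * (hs + A) / (1 - m')"
        using F(1) h(2) pert(1)[OF close, of h] by simp
      moreover have "2 * \<bar>m' - m\<bar> * \<bar>hs + A\<bar> / \<bar>1 - m\<bar> \<le> 2 * E \<delta> * \<bar>hs + A\<bar> / \<bar>1 - m\<bar>"
        using m' by (intro divide_right_mono mult_right_mono) auto
      ultimately have "\<bar>h - hs\<bar> < \<epsilon>" using pert(2)[OF close] E(3) by simp
      moreover have "deriv (smoothed_return_map \<mu> a f \<delta> (p1 + p2)) h = m'"
        using F(2) by (rule DERIV_imp_deriv)
      ultimately show ?thesis using m' E(2) by simp
    qed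
    then show ?thesis using \<delta>1(1) by blast
  qed

  have "\<delta>0 > 0" using box \<delta>'' by (simp add: \<delta>0_def)
  show ?thesis
    unfolding deriv_F
  proof (rule conjI[OF m_def], rule exI[of _ r], rule conjI[OF box(1)], rule exI[of _ \<delta>0],
      rule conjI[OF \<open>\<delta>0 > 0\<close>], rule exI[of _ \<rho>0], rule conjI[OF box(3)], rule conjI)
  qed (intro allI impI, elim conjE, rule existence, assumption+, intro allI impI, rule convergence, assumption)
qed

end
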